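(* Let $\gamma\in(0,1)$, $\beta>1$, $\alpha_n=1-\gamma/n^\beta$ and $\sigma_n>0$ for $n\in\mathbb{N}$, and for each $n$ let $(X_{j,n})_{j\ge0}$ be the stationary process satisfying $X_{j,n}=\alpha_nX_{j-1,n}+\sigma_n\varepsilon_j$ for $j\ge1$, where $(\varepsilon_j)$ are i.i.d. $\mathcal{N}(0,1)$ independent of $X_{0,n}\sim\mathcal{N}(0,\delta_n^2)$, $\delta_n^2=\sigma_n^2/(1-\alpha_n^2)$. Let $1\le m\le p$ be integers, let $c_m,\dots,c_p$ be fixed reals with $c_m\ne0$, $c_p\ne0$, and set $$f_n(x)=\sum_{q=m}^pc_q\,\delta_n^q\,H_q(x/\delta_n).$$ Let $Z\sim\mathcal{N}(0,1)$. (i) If $\sigma_n^2\gg1-\alpha_n^2$, then $\big(\hat S_{n,t}(f_n)\big)_{t\in[0,1]}\longrightarrow_{\mathcal D}\Big(t\,\frac{H_p(Z)}{\sqrt{p!}}\Big)_{t\in[0,1]}$ in $D[0,1]$ as $n\to\infty$. (ii) If $\sigma_n^2\ll1-\alpha_n^2$, then $\big(\hat S_{n,t}(f_n)\big)_{t\in[0,1]}\longrightarrow_{\mathcal D}\Big(t\,\frac{H_m(Z)}{\sqrt{m!}}\Big)_{t\in[0,1]}$ in $D[0,1]$ as $n\to\infty$.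
   Context: For $t\in[0,1]$, $S_{n,t}(g)=\sum_{k=1}^{\lfloor nt\rfloor}g(X_{k,n})$ and $\hat S_{n,t}(g)=\dfrac{S_{n,t}(g)-\mathbb{E}S_{n,t}(g)}{\sqrt{\mathrm{Var}\,S_{n,1}(g)}}$. $H_q$ is the (probabilists') Hermite polynomial of order $q$. $D[0,1]$ is the Skorokhod space with the Skorokhod topology; $\longrightarrow_{\mathcal D}$ is convergence in distribution. For positive sequences, $x_n\gg y_n$ (equivalently $y_n\ll x_n$) means $y_n=o(x_n)$.
   Formalization: The limits are t·sgn(c_p)·H_p(Z)/√(p!) in (i) and t·sgn(c_m)·H_m(Z)/√(m!) in (ii); without the sign the claim fails for a negative coefficient of even degree, e.g. m=p=2, c_2=−1. *)

theory Defs
  imports "HOL-Probability.Probability" "HOL-Library.Landau_Symbols"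
begin

section \<open>Hermite polynomials\<close>

text \<open>The probabilists' normalisation: monic and orthogonal with respect to the standard normal law.\<close>

fun hermite :: "nat \<Rightarrow> real \<Rightarrow> real" where
  "hermite 0 x = 1"
| "hermite (Suc 0) x = x"
| "hermite (Suc (Suc q)) x = x * hermite (Suc q) x - real (Suc q) * hermite q x"


section \<open>The Skorokhod space on the unit interval\<close>

text \<open>Right-continuous functions with left limits on \<open>[0,1]\<close>. Values outside \<open>[0,1]\<close> are fixed by
  extensionality, so that equality in this set is equality on \<open>[0,1]\<close>.\<close>

definition cadlag :: "(real \<Rightarrow> real) set" where
  "cadlag = {x \<in> extensional {0..1}.
     (\<forall>t\<in>{0..<1}. (x \<longlongrightarrow> x t) (at_right t)) \<and>
     (\<forall>t\<in>{0<..1}. \<exists>l. (x \<longlongrightarrow> l) (at_left t))}"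

definition time_changes :: "(real \<Rightarrow> real) set" where
  "time_changes = {\<tau>. strict_mono_on {0..1} \<tau> \<and> continuous_on {0..1} \<tau> \<and> \<tau> ` {0..1} = {0..1}}"

definition skorokhod_within :: "real \<Rightarrow> (real \<Rightarrow> real) \<Rightarrow> (real \<Rightarrow> real) \<Rightarrow> bool" where
  "skorokhod_within r x y \<longleftrightarrow> 0 < r \<and> (\<exists>\<tau>\<in>time_changes. \<forall>t\<in>{0..1}.
     \<bar>\<tau> t - t\<bar> \<le> r \<and> \<bar>x t - y (\<tau> t)\<bar> \<le> r)"

text \<open>Billingsley's first metric (not the complete one), which metrises the Skorokhod (J1)
  topology. The \<open>else\<close> branch is irrelevant junk: \<^const>\<open>Metric_space\<close> wants a function that is
  nonnegative everywhere, and the infimum of the empty set of reals is unspecified.\<close>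

definition skorokhod_dist :: "(real \<Rightarrow> real) \<Rightarrow> (real \<Rightarrow> real) \<Rightarrow> real" where
  "skorokhod_dist x y =
     (if x \<in> cadlag \<and> y \<in> cadlag then Inf {r. skorokhod_within r x y} else 0)"

lemma cadlag_bounded:
  assumes "x \<in> cadlag"
  shows "bounded (x ` {0..1})"
proof -
  have loc: "\<exists>e>0. bounded (x ` ({0..1} \<inter> {t-e<..<t+e}))" if t: "t \<in> {0..1}" for t
  proof -
    have "\<exists>b>t. bounded (x ` ({0..1} \<inter> {t<..<b}))"
    proof (cases "t < 1")
      case True
      then have "(x \<longlongrightarrow> x t) (at_right t)"
        using assms t by (auto simp: cadlag_def)
      then have "\<forall>\<^sub>F s in at_right t. dist (x s) (x t) < 1"
        by (rule tendstoD) simp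
      then obtain b where b: "b > t" "\<And>s. t < s \<Longrightarrow> s < b \<Longrightarrow> dist (x s) (x t) < 1"
        by (auto simp: eventually_at_right[of t "t+1"])
      have "x ` ({0..1} \<inter> {t<..<b}) \<subseteq> ball (x t) 1"
        using b(2) by (auto simp: dist_commute)
      then show ?thesis
        using b(1) bounded_subset[OF bounded_ball] by blast
    next
      case False
      then have "{0..1} \<inter> {t<..<t+1} = {}"
        by auto
      then show ?thesis
        by (intro exI[of _ "t+1"]) simp
    qed
    then obtain b where b: "b > t" "bounded (x ` ({0..1} \<inter> {t<..<b}))"
      by blast
    have "\<exists>a<t. bounded (x ` ({0..1} \<inter> {a<..<t}))"
    proof (cases "t > 0")
      case True
      then obtain l where "(x \<longlongrightarrow> l) (at_left t)"
        using assms t by (fastforce simp: cadlag_def)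
      then have "\<forall>\<^sub>F s in at_left t. dist (x s) l < 1"
        by (rule tendstoD) simp
      then obtain a where a: "a < t" "\<And>s. a < s \<Longrightarrow> s < t \<Longrightarrow> dist (x s) l < 1"
        by (auto simp: eventually_at_left[of "t-1" t])
      have "x ` ({0..1} \<inter> {a<..<t}) \<subseteq> ball l 1"
        using a(2) by (auto simp: dist_commute)
      then show ?thesis
        using a(1) bounded_subset[OF bounded_ball] by blast
    next
      case False
      then have "{0..1} \<inter> {t-1<..<t} = {}"
        by auto
      then show ?thesis
        by (intro exI[of _ "t-1"]) simp
    qed
    then obtain a where a: "a < t" "bounded (x ` ({0..1} \<inter> {a<..<t}))"
      by blast
    define e where "e = min (t - a) (b - t)"
    have "x ` ({0..1} \<inter> {t-e<..<t+e}) \<subseteq>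
        insert (x t) (x ` ({0..1} \<inter> {a<..<t}) \<union> x ` ({0..1} \<inter> {t<..<b}))"
    proof
      fix y assume "y \<in> x ` ({0..1} \<inter> {t-e<..<t+e})"
      then obtain s where s: "y = x s" "s \<in> {0..1}" "t - e < s" "s < t + e"
        by auto
      have "a < s" "s < b"
        using s by (auto simp: e_def)
      then show "y \<in> insert (x t) (x ` ({0..1} \<inter> {a<..<t}) \<union> x ` ({0..1} \<inter> {t<..<b}))"
        using s by (cases s t rule: linorder_cases) auto
    qed
    then have "bounded (x ` ({0..1} \<inter> {t-e<..<t+e}))"
      using a b by (meson bounded_subset bounded_insert bounded_Un)
    moreover have "e > 0"
      using a b by (simp add: e_def)
    ultimately show ?thesis
      by blast
  qed
  then obtain e where e: "\<And>t. t \<in> {0..1} \<Longrightarrow> e t > 0"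
      "\<And>t. t \<in> {0..1} \<Longrightarrow> bounded (x ` ({0..1} \<inter> {t-e t<..<t+e t}))"
    by metis
  have cover: "{0..1} \<subseteq> (\<Union>t\<in>{0..1}. {t-e t<..<t+e t})"
    using e(1) by force
  obtain C where C: "C \<subseteq> {0..1}" "finite C" "{0..1} \<subseteq> (\<Union>t\<in>C. {t-e t<..<t+e t})"
    using compactE_image[OF compact_Icc _ cover] open_greaterThanLessThan by metis
  have "x ` {0..1} \<subseteq> (\<Union>t\<in>C. x ` ({0..1} \<inter> {t-e t<..<t+e t}))"
    using C(3) by blast
  moreover have "bounded (\<Union>t\<in>C. x ` ({0..1} \<inter> {t-e t<..<t+e t}))"
    using C e(2) by (intro bounded_UN) auto
  ultimately show ?thesis
    by (rule bounded_subset[rotated])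
qed

lemma time_changes_id: "(\<lambda>t. t) \<in> time_changes"
  by (auto simp: time_changes_def strict_mono_on_def)

lemma time_changes_mem: "\<tau> \<in> time_changes \<Longrightarrow> t \<in> {0..1} \<Longrightarrow> \<tau> t \<in> {0..1}"
  by (auto simp: time_changes_def)

lemma time_changes_1:
  assumes "\<tau> \<in> time_changes"
  shows "\<tau> 1 = 1"
proof -
  have "1 \<in> \<tau> ` {0..1}"
    using assms by (simp add: time_changes_def)
  then obtain t where t: "t \<in> {0..1}" "\<tau> t = 1"
    by auto
  have "\<tau> t < \<tau> 1" if "t < 1"
    using assms t(1) that unfolding time_changes_def
    by (intro strict_mono_onD[of "{0..1}" \<tau>]) auto
  moreover have "\<tau> 1 \<le> 1"
    using time_changes_mem[OF assms, of 1] by simp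
  ultimately show ?thesis
    using t by force
qed

lemma time_changes_comp:
  assumes "\<tau> \<in> time_changes" "\<mu> \<in> time_changes"
  shows "(\<lambda>t. \<mu> (\<tau> t)) \<in> time_changes"
proof -
  have t: "strict_mono_on {0..1} \<tau>" "continuous_on {0..1} \<tau>" "\<tau> ` {0..1} = {0..1}"
    and m: "strict_mono_on {0..1} \<mu>" "continuous_on {0..1} \<mu>" "\<mu> ` {0..1} = {0..1}"
    using assms unfolding time_changes_def by blast+
  have "continuous_on {0..1} (\<mu> \<circ> \<tau>)"
    by (rule continuous_on_compose[OF t(2)]) (simp only: t(3) m(2))
  moreover have "(\<mu> \<circ> \<tau>) ` {0..1} = {0..1}"
    by (simp only: image_comp[symmetric] t(3) m(3))
  moreover have "strict_mono_on {0..1} (\<mu> \<circ> \<tau>)"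
  proof (rule strict_mono_onI)
    fix r s :: real assume "r \<in> {0..1}" "s \<in> {0..1}" "r < s"
    then show "(\<mu> \<circ> \<tau>) r < (\<mu> \<circ> \<tau>) s"
      unfolding o_def
      by (intro strict_mono_onD[OF m(1)] strict_mono_onD[OF t(1)] time_changes_mem[OF assms(1)])
  qed
  ultimately show ?thesis
    unfolding time_changes_def o_def by blast
qed

lemma time_changes_inverse:
  assumes "\<tau> \<in> time_changes"
  shows "\<exists>\<mu>\<in>time_changes. \<forall>t\<in>{0..1}. \<tau> (\<mu> t) = t"
proof -
  let ?\<mu> = "the_inv_into {0..1} \<tau>"
  have sm: "strict_mono_on {0..1} \<tau>" and im: "\<tau> ` {0..1} = {0..1}"
    and co: "continuous_on {0..1} \<tau>"
    using assms by (auto simp: time_changes_def)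
  have inj: "inj_on \<tau> {0..1}"
    using sm by (rule strict_mono_on_imp_inj_on)
  have inv: "\<tau> (?\<mu> t) = t" if "t \<in> {0..1}" for t
    by (rule f_the_inv_into_f[OF inj]) (simp only: im that)
  have mem: "?\<mu> t \<in> {0..1}" if "t \<in> {0..1}" for t
    by (rule the_inv_into_into[OF inj _ order_refl]) (simp only: im that)
  have "strict_mono_on {0..1} ?\<mu>"
  proof (rule strict_mono_onI)
    fix s t :: real assume st: "s \<in> {0..1}" "t \<in> {0..1}" "s < t"
    show "?\<mu> s < ?\<mu> t"
    proof (rule ccontr)
      assume "\<not> ?thesis"
      then have le: "?\<mu> t \<le> ?\<mu> s"
        by simp
      have "\<tau> (?\<mu> t) \<le> \<tau> (?\<mu> s)"
        by (rule monotone_onD[OF strict_mono_on_imp_mono_on[OF sm] mem[OF st(2)] mem[OF st(1)] le])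
      then show False
        unfolding inv[OF st(1)] inv[OF st(2)] using st(3) by simp
    qed
  qed
  moreover have "continuous_on {0..1} ?\<mu>"
    using continuous_on_inv[OF co compact_Icc, of ?\<mu>] the_inv_into_f_f[OF inj] unfolding im by blast
  moreover have "?\<mu> ` {0..1} = {0..1}"
    using the_inv_into_onto[OF inj] unfolding im .
  ultimately have "?\<mu> \<in> time_changes"
    unfolding time_changes_def by blast
  then show ?thesis
    using inv by blast
qed

lemma skorokhod_within_ex:
  assumes "x \<in> cadlag" "y \<in> cadlag"
  shows "\<exists>r. skorokhod_within r x y"
proof -
  obtain B where B: "\<And>t. t \<in> {0..1} \<Longrightarrow> \<bar>x t\<bar> \<le> B"
    using cadlag_bounded[OF assms(1)] unfolding bounded_iff by (metis image_eqI real_norm_def)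
  obtain C where C: "\<And>t. t \<in> {0..1} \<Longrightarrow> \<bar>y t\<bar> \<le> C"
    using cadlag_bounded[OF assms(2)] unfolding bounded_iff by (metis image_eqI real_norm_def)
  have "B \<ge> 0" "C \<ge> 0"
    using B[of 0] C[of 0] by auto
  moreover have "\<bar>x t - y t\<bar> \<le> B + C + 1" if "t \<in> {0..1}" for t
    using B[OF that] C[OF that] by linarith
  ultimately have "skorokhod_within (B + C + 1) x y"
    unfolding skorokhod_within_def
    by (intro conjI bexI[OF _ time_changes_id] ballI) auto
  then show ?thesis ..
qed

lemma skorokhod_within_bdd: "bdd_below {r. skorokhod_within r x y}"
  by (rule bdd_belowI[of _ 0]) (auto simp: skorokhod_within_def)

lemma skorokhod_within_sym:
  assumes "skorokhod_within r x y"
  shows "skorokhod_within r y x"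
proof -
  obtain \<tau> where l: "\<tau> \<in> time_changes"
      "\<And>t. t \<in> {0..1} \<Longrightarrow> \<bar>\<tau> t - t\<bar> \<le> r \<and> \<bar>x t - y (\<tau> t)\<bar> \<le> r"
    using assms by (auto simp: skorokhod_within_def)
  obtain \<mu> where m: "\<mu> \<in> time_changes" "\<And>t. t \<in> {0..1} \<Longrightarrow> \<tau> (\<mu> t) = t"
    using time_changes_inverse[OF l(1)] by blast
  have "\<bar>\<mu> t - t\<bar> \<le> r \<and> \<bar>y t - x (\<mu> t)\<bar> \<le> r" if t: "t \<in> {0..1}" for t
    using l(2)[OF time_changes_mem[OF m(1) t]] m(2)[OF t]
    by (simp add: abs_minus_commute)
  moreover have "0 < r"
    using assms by (simp add: skorokhod_within_def)
  ultimately show ?thesis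
    unfolding skorokhod_within_def using m(1) by blast
qed

lemma skorokhod_within_trans:
  assumes "skorokhod_within r x y" "skorokhod_within s y z"
  shows "skorokhod_within (r + s) x z"
proof -
  obtain \<tau> where l: "\<tau> \<in> time_changes"
      "\<And>t. t \<in> {0..1} \<Longrightarrow> \<bar>\<tau> t - t\<bar> \<le> r \<and> \<bar>x t - y (\<tau> t)\<bar> \<le> r"
    using assms(1) by (auto simp: skorokhod_within_def)
  obtain \<mu> where m: "\<mu> \<in> time_changes"
      "\<And>t. t \<in> {0..1} \<Longrightarrow> \<bar>\<mu> t - t\<bar> \<le> s \<and> \<bar>y t - z (\<mu> t)\<bar> \<le> s"
    using assms(2) by (auto simp: skorokhod_within_def)
  have close: "\<bar>\<mu> (\<tau> t) - t\<bar> \<le> r + s \<and> \<bar>x t - z (\<mu> (\<tau> t))\<bar> \<le> r + s" if t: "t \<in> {0..1}" for t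
    using l(2)[OF t] m(2)[OF time_changes_mem[OF l(1) t]] by linarith
  have "0 < r + s"
    using assms by (simp add: skorokhod_within_def)
  then show ?thesis
    unfolding skorokhod_within_def
    by (rule conjI) (rule bexI[OF _ time_changes_comp[OF l(1) m(1)]], rule ballI, rule close)
qed

lemma skorokhod_dist_less_iff:
  assumes "x \<in> cadlag" "y \<in> cadlag"
  shows "skorokhod_dist x y < e \<longleftrightarrow> (\<exists>r<e. skorokhod_within r x y)"
proof -
  have "{r. skorokhod_within r x y} \<noteq> {}"
    using skorokhod_within_ex[OF assms] by simp
  then have "Inf {r. skorokhod_within r x y} < e \<longleftrightarrow> (\<exists>r\<in>{r. skorokhod_within r x y}. r < e)"
    by (rule cInf_less_iff) (rule skorokhod_within_bdd)
  then show ?thesis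
    using assms unfolding skorokhod_dist_def by auto
qed

lemma cadlag_eqI:
  assumes x: "x \<in> cadlag" and y: "y \<in> cadlag"
    and close: "\<And>e. e > 0 \<Longrightarrow> \<exists>r<e. skorokhod_within r x y"
  shows "x = y"
proof (rule extensionalityI[of _ "{0..1}"])
  show "x \<in> extensional {0..1}" "y \<in> extensional {0..1}"
    using x y by (auto simp: cadlag_def)
  fix t :: real assume t: "t \<in> {0..1}"
  show "x t = y t"
  proof (rule ccontr)
    assume ne: "x t \<noteq> y t"
    define e where "e = \<bar>x t - y t\<bar> / 3"
    have e: "e > 0"
      using ne by (simp add: e_def)
    show False
    proof (cases "t = 1")
      case True
      obtain r \<tau> where "r < e" "\<tau> \<in> time_changes" "\<bar>x 1 - y (\<tau> 1)\<bar> \<le> r"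
        using close[OF e] by (fastforce simp: skorokhod_within_def)
      then show False
        using time_changes_1[of \<tau>] True e by (simp add: e_def)
    next
      case False
      then have "(x \<longlongrightarrow> x t) (at_right t)" "(y \<longlongrightarrow> y t) (at_right t)"
        using x y t by (auto simp: cadlag_def)
      then have "\<forall>\<^sub>F s in at_right t. dist (x s) (x t) < e \<and> dist (y s) (y t) < e"
        using e by (intro eventually_conj tendstoD)
      then obtain b where b: "b > t"
          "\<And>s. t < s \<Longrightarrow> s < b \<Longrightarrow> dist (x s) (x t) < e \<and> dist (y s) (y t) < e"
        by (auto simp: eventually_at_right[of t "t+1"])
      define h where "h = min b 1 - t"
      have h: "h > 0" "t + h \<le> b" "t + h \<le> 1"
        using b(1) False t by (auto simp: h_def)
      define s where "s = t + h / 2"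
      have s: "s \<in> {0..1}"
        using h t by (auto simp: s_def)
      obtain r \<tau> where l: "r < min e (h / 4)" "\<bar>\<tau> s - s\<bar> \<le> r" "\<bar>x s - y (\<tau> s)\<bar> \<le> r"
        using close[of "min e (h / 4)"] e h s unfolding skorokhod_within_def
        by (metis min_less_iff_conj zero_less_divide_iff zero_less_numeral)
      have "dist (x s) (x t) < e"
        using b(2)[of s] h by (simp add: s_def)
      moreover have "t < \<tau> s" "\<tau> s < b"
        using h l(1,2) unfolding s_def by linarith+
      then have "dist (y (\<tau> s)) (y t) < e"
        using b(2)[of "\<tau> s"] by simp
      moreover have "r < e"
        using l(1) by simp
      ultimately have "\<bar>x t - y t\<bar> < 3 * e"
        using l(3) unfolding dist_real_def by linarith
      then show False
        by (simp add: e_def)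
    qed
  qed
qed

interpretation skorokhod: Metric_space cadlag skorokhod_dist
proof
  fix x y z
  show "0 \<le> skorokhod_dist x y"
    using skorokhod_within_ex[of x y] unfolding skorokhod_dist_def
    by (auto intro!: cInf_greatest simp: skorokhod_within_def)
  show "skorokhod_dist x y = skorokhod_dist y x"
  proof -
    have "{r. skorokhod_within r x y} = {r. skorokhod_within r y x}"
      using skorokhod_within_sym by blast
    then show ?thesis
      by (simp add: skorokhod_dist_def)
  qed
  assume x: "x \<in> cadlag" and y: "y \<in> cadlag"
  show "skorokhod_dist x y = 0 \<longleftrightarrow> x = y"
  proof
    assume "skorokhod_dist x y = 0"
    then show "x = y"
      using skorokhod_dist_less_iff[OF x y] by (intro cadlag_eqI[OF x y]) auto
  next
    assume "x = y"
    have "skorokhod_dist x x < e" if e: "e > 0" for e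
    proof -
      have "skorokhod_within (e / 2) x x"
        using e unfolding skorokhod_within_def
        by (intro conjI bexI[OF _ time_changes_id]) auto
      then show ?thesis
        using e skorokhod_dist_less_iff[OF x x] by (auto intro!: exI[of _ "e / 2"])
    qed
    then have "\<not> 0 < skorokhod_dist x x"
      by blast
    with \<open>0 \<le> skorokhod_dist x y\<close> \<open>x = y\<close> show "skorokhod_dist x y = 0"
      by simp
  qed
  assume z: "z \<in> cadlag"
  show "skorokhod_dist x z \<le> skorokhod_dist x y + skorokhod_dist y z"
  proof (rule field_le_epsilon)
    fix e :: real assume e: "e > 0"
    have "skorokhod_dist x y < skorokhod_dist x y + e / 2"
         "skorokhod_dist y z < skorokhod_dist y z + e / 2"
      using e by auto
    then obtain r s where "r < skorokhod_dist x y + e / 2" "skorokhod_within r x y"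
        "s < skorokhod_dist y z + e / 2" "skorokhod_within s y z"
      using skorokhod_dist_less_iff[OF x y] skorokhod_dist_less_iff[OF y z] by metis
    then have "\<exists>r'<skorokhod_dist x y + skorokhod_dist y z + e. skorokhod_within r' x z"
      using skorokhod_within_trans[of r x y s z] by (intro exI[of _ "r + s"]) auto
    then show "skorokhod_dist x z \<le> skorokhod_dist x y + skorokhod_dist y z + e"
      using skorokhod_dist_less_iff[OF x z] by (intro less_imp_le) blast
  qed
qed

abbreviation skorokhod_topology :: "(real \<Rightarrow> real) topology" where
  "skorokhod_topology \<equiv> skorokhod.mtopology"


section \<open>Convergence in distribution of random elements of a topological space\<close>

definition borel_sets_of :: "'c topology \<Rightarrow> 'c measure" where
  "borel_sets_of T = sigma (topspace T) {U. openin T U}"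

definition converges_in_distribution ::
    "'c topology \<Rightarrow> 'a measure \<Rightarrow> (nat \<Rightarrow> 'a \<Rightarrow> 'c) \<Rightarrow> 'b measure \<Rightarrow> ('b \<Rightarrow> 'c) \<Rightarrow> bool" where
  "converges_in_distribution T M Y N Y\<^sub>0 \<longleftrightarrow>
     (\<forall>n. Y n \<in> measurable M (borel_sets_of T)) \<and> Y\<^sub>0 \<in> measurable N (borel_sets_of T) \<and>
     (\<forall>h. continuous_map T euclideanreal h \<and> bounded (h ` topspace T) \<longrightarrow>
       (\<lambda>n. \<integral>\<omega>. h (Y n \<omega>) \<partial>M) \<longlonglongrightarrow> (\<integral>\<omega>. h (Y\<^sub>0 \<omega>) \<partial>N))"

text \<open>A real process \<open>Y\<close>, as a random element of the Skorokhod space.\<close>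

definition path_of :: "(real \<Rightarrow> 'a \<Rightarrow> real) \<Rightarrow> 'a \<Rightarrow> real \<Rightarrow> real" where
  "path_of Y \<omega> = (\<lambda>t\<in>{0..1}. Y t \<omega>)"


section \<open>Normalised partial sums of a triangular array\<close>

text \<open>\<open>X n k\<close> is the random variable usually written with indices in the order \<open>k, n\<close>.\<close>

definition partial_sum ::
    "(nat \<Rightarrow> nat \<Rightarrow> 'a \<Rightarrow> real) \<Rightarrow> (real \<Rightarrow> real) \<Rightarrow> nat \<Rightarrow> real \<Rightarrow> 'a \<Rightarrow> real" where
  "partial_sum X g n t \<omega> = (\<Sum>k = 1..nat \<lfloor>real n * t\<rfloor>. g (X n k \<omega>))"

definition normalized_sum ::
    "'a measure \<Rightarrow> (nat \<Rightarrow> nat \<Rightarrow> 'a \<Rightarrow> real) \<Rightarrow> (real \<Rightarrow> real) \<Rightarrow> nat \<Rightarrow> real \<Rightarrow> 'a \<Rightarrow> real" where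
  "normalized_sum M X g n t \<omega> =
     (partial_sum X g n t \<omega> - prob_space.expectation M (partial_sum X g n t))
       / sqrt (prob_space.variance M (partial_sum X g n 1))"

end

theory Submission
  imports Defs
begin

text \<open>
  Because \<open>n (1 - \<alpha>\<^sub>n) = \<gamma> n powr (1 - \<beta>)\<close> tends to zero, the autoregression hardly forgets its
  starting point during the \<open>n\<close> steps that are observed: each \<open>W\<^sub>k = X\<^sub>k / \<delta>\<^sub>n\<close> with \<open>k \<le> n\<close> is close to
  \<open>W\<^sub>0\<close>. Hence \<open>S\<^sub>n\<^sub>,\<^sub>t\<close> is close to \<open>\<lfloor>n t\<rfloor> f\<^sub>n (X\<^sub>0)\<close>, its standard deviation at \<open>t = 1\<close> is close to
  \<open>n\<close> times that of \<open>f\<^sub>n (X\<^sub>0)\<close>, and the normalised process is close to a straight line with the random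
  slope \<open>f\<^sub>n (X\<^sub>0) / sd (f\<^sub>n (X\<^sub>0))\<close>. In the variable \<open>W\<^sub>0\<close> this slope is a Hermite combination whose
  coefficients are \<open>c\<^sub>q \<delta>\<^sub>n\<^sup>q\<close>, rescaled so that its variance is one; when \<open>\<delta>\<^sub>n\<close> tends to infinity only the
  top degree survives, when \<open>\<delta>\<^sub>n\<close> tends to zero only the bottom one, and of its coefficient only
  the sign is left.

  Closeness is quantified by covariances. One has \<open>W\<^sub>k = a W\<^sub>0 + V\<close> with \<open>a = \<alpha>\<^sub>n\<^sup>k\<close> and an independent
  centred normal \<open>V\<close> of variance \<open>1 - a\<^sup>2\<close>, and averaging a Hermite polynomial over such a noise
  multiplies it by \<open>a\<^sup>q\<close> (\<open>gauss_mean_hermite_affine\<close>, from Stein's identity). So the mean square of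
  \<open>H\<^sub>q (W\<^sub>k) - H\<^sub>q (W\<^sub>0)\<close> is exactly \<open>2 q! (1 - \<alpha>\<^sub>n\<^sup>k\<^sup>q)\<close> (\<open>stationary_ar_hermite\<close>), which Bernoulli's
  inequality bounds by a multiple of \<open>n (1 - \<alpha>\<^sub>n)\<close> for all \<open>k \<le> n\<close> at once. It is essential to compare
  \<open>W\<^sub>k\<close> with \<open>W\<^sub>0\<close> directly: adding up one-step \<open>L\<^sup>2\<close> errors costs \<open>n sqrt (1 - \<alpha>\<^sub>n)\<close>, which need not be small.

  In the Skorokhod space the uniform distance between the process and the line \<open>t G\<^sub>n\<close> tends to zero
  in \<open>L\<^sup>1\<close>, where \<open>G\<^sub>n\<close> is the limiting Hermite combination in \<open>W\<^sub>0\<close> and so has a law free of \<open>n\<close>. The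
  lines with bounded slope form a compact set, near which a continuous functional is uniformly
  controlled (\<open>converges_in_distribution_ray\<close>). The probabilistic estimates and this argument are joined in
  \<open>hermite_array_limit\<close>.
\<close>

section \<open>Hermite polynomials under the standard normal law\<close>

definition std_normal :: "real measure" where
  "std_normal = density lborel std_normal_density"

lemma sets_std_normal [simp, measurable_cong]: "sets std_normal = sets borel"
  by (simp add: std_normal_def)

lemma space_std_normal [simp]: "space std_normal = UNIV"
  by (simp add: std_normal_def)

interpretation std_normal: prob_space std_normal
  unfolding std_normal_def by (rule prob_space_normal_density) simp

lemma borel_measurable_poly [measurable]: "poly (p :: real poly) \<in> borel_measurable borel"
  by (intro borel_measurable_continuous_onI continuous_intros)

lemma integrable_std_normal_power: "integrable std_normal (\<lambda>x. x ^ k)"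
  unfolding std_normal_def by (subst integrable_real_density) (auto intro: integrable_std_normal_moment)

lemma integrable_std_normal_poly: "integrable std_normal (poly p)"
  unfolding poly_altdef by (intro integrable_std_normal_power Bochner_Integration.integrable_sum
    integrable_mult_right)

text \<open>The expectation of \<open>p (Z)\<close>. On the type of polynomials it is a linear functional, since every
  polynomial is integrable, and the identities below become algebra.\<close>

definition gauss_mean :: "real poly \<Rightarrow> real" where
  "gauss_mean p = (\<integral>x. poly p x \<partial>std_normal)"

lemma gauss_mean_add: "gauss_mean (p + q) = gauss_mean p + gauss_mean q"
  by (simp add: gauss_mean_def integrable_std_normal_poly)

lemma gauss_mean_diff: "gauss_mean (p - q) = gauss_mean p - gauss_mean q"
  by (simp add: gauss_mean_def integrable_std_normal_poly)

lemma gauss_mean_smult: "gauss_mean (smult a p) = a * gauss_mean p"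
  by (simp add: gauss_mean_def)

lemma gauss_mean_0 [simp]: "gauss_mean 0 = 0"
  by (simp add: gauss_mean_def)

lemma gauss_mean_1 [simp]: "gauss_mean 1 = 1"
  using std_normal.prob_space by (simp add: gauss_mean_def)

lemma gauss_mean_monom:
  "gauss_mean (monom 1 k) = (\<integral>x. std_normal_density x * x ^ k \<partial>lborel)"
  unfolding gauss_mean_def std_normal_def
  by (subst integral_real_density) (auto simp: poly_monom)

lemma gauss_mean_monom_Suc_Suc:
  "gauss_mean (monom 1 (Suc (Suc k))) = real (Suc k) * gauss_mean (monom 1 k)"
proof (cases "even k")
  case True
  then obtain j where k: "k = 2 * j" by (elim evenE)
  have *: "Suc (Suc k) = 2 * Suc j" by (simp add: k)
  have num: "fact (2 * Suc j) = 2 * real (Suc j) * (real (Suc (2 * j)) * fact (2 * j))"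
    by simp
  have den: "2 ^ Suc j * fact (Suc j) = 2 * real (Suc j) * (2 ^ j * fact j)"
    by simp
  have "fact (2 * Suc j) / (2 ^ Suc j * fact (Suc j)) = real (Suc (2 * j)) * (fact (2 * j) / (2 ^ j * fact j))"
    unfolding num den times_divide_eq_right by (rule mult_divide_mult_cancel_left) simp
  then show ?thesis
    unfolding gauss_mean_monom * unfolding k integral_std_normal_moment_even .
next
  case False
  then obtain j where k: "k = 2 * j + 1" by (elim oddE)
  have *: "Suc (Suc k) = 2 * Suc j + 1" by (simp add: k)
  show ?thesis
    unfolding gauss_mean_monom * integral_std_normal_moment_odd
    unfolding k integral_std_normal_moment_odd by simp
qed

lemma gauss_mean_monom_Suc: "gauss_mean (monom 1 (Suc k)) = gauss_mean (pderiv (monom 1 k))"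
proof (cases k)
  case 0
  then show ?thesis
    using integral_std_normal_moment_odd[of 0]
    by (simp add: gauss_mean_monom pderiv_monom del: One_nat_def)
next
  case (Suc j)
  have "pderiv (monom 1 k) = smult (real (Suc j)) (monom 1 j)"
    by (simp add: Suc pderiv_monom smult_monom)
  then show ?thesis
    using gauss_mean_monom_Suc_Suc[of j] by (simp add: Suc gauss_mean_smult)
qed

text \<open>Stein's identity \<open>E (Z p (Z)) = E (p' (Z))\<close>, with an extra factor \<open>Z\<^sup>k\<close> that makes the induction
  over the coefficients of \<open>p\<close> go through: peeling off a coefficient raises the power by one.\<close>

lemma gauss_mean_stein_monom:
  "gauss_mean (monom 1 (Suc k) * p) = gauss_mean (pderiv (monom 1 k * p))"
proof (induction p arbitrary: k)
  case 0
  show ?case by simp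
next
  case (pCons a p)
  have split: "monom 1 j * pCons a p = smult a (monom 1 j) + monom 1 (Suc j) * p" for j
    by (simp add: monom_Suc)
  show ?case
    unfolding split pderiv_add pderiv_smult gauss_mean_add gauss_mean_smult
      pCons.IH gauss_mean_monom_Suc by simp
qed

lemma gauss_mean_stein: "gauss_mean (pCons 0 p) = gauss_mean (pderiv p)"
  using gauss_mean_stein_monom[of 0 p] by (simp add: monom_Suc monom_0)

text \<open>The recursion \<open>H\<^sub>q\<^sub>+\<^sub>1 = x H\<^sub>q - H\<^sub>q'\<close>, rather than the three-term one, is what fits Stein's identity.\<close>

fun hermite_poly :: "nat \<Rightarrow> real poly" where
  "hermite_poly 0 = 1"
| "hermite_poly (Suc q) = pCons 0 (hermite_poly q) - pderiv (hermite_poly q)"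

lemma pderiv_hermite_poly_Suc:
  "pderiv (hermite_poly (Suc q)) = smult (real (Suc q)) (hermite_poly q)"
proof (induction q)
  case 0
  show ?case by (simp add: pderiv_pCons)
next
  case (Suc q)
  have "pderiv (hermite_poly (Suc (Suc q))) =
      hermite_poly (Suc q) + pCons 0 (pderiv (hermite_poly (Suc q))) - pderiv (pderiv (hermite_poly (Suc q)))"
    by (simp only: hermite_poly.simps(2)[of "Suc q"] pderiv_diff pderiv_pCons)
  also have "\<dots> = hermite_poly (Suc q)
      + (pCons 0 (smult (real (Suc q)) (hermite_poly q)) - smult (real (Suc q)) (pderiv (hermite_poly q)))"
    unfolding Suc.IH pderiv_smult by (rule add_diff_eq[symmetric])
  also have "pCons 0 (smult (real (Suc q)) (hermite_poly q)) - smult (real (Suc q)) (pderiv (hermite_poly q))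
      = smult (real (Suc q)) (hermite_poly (Suc q))"
    by (simp only: hermite_poly.simps(2)[of q] smult_diff_right smult_pCons mult_zero_right)
  also have "hermite_poly (Suc q) + smult (real (Suc q)) (hermite_poly (Suc q))
      = smult (real (Suc (Suc q))) (hermite_poly (Suc q))"
    by (simp only: of_nat_Suc[of "Suc q"] smult_add_left smult_1_left)
  finally show ?case .
qed

lemma poly_hermite_poly: "poly (hermite_poly q) x = hermite q x"
proof (induction q x rule: hermite.induct)
  case (3 q x)
  show ?case
    by (simp only: hermite_poly.simps(2)[of "Suc q"] pderiv_hermite_poly_Suc poly_diff poly_pCons
        poly_smult 3 hermite.simps(3) add_0)
qed (simp_all add: pderiv_pCons)

lemma borel_measurable_hermite [measurable]: "hermite q \<in> borel_measurable borel"
  using borel_measurable_poly[of "hermite_poly q"] by (simp add: poly_hermite_poly[abs_def])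

text \<open>Multiplication by \<open>x\<close> minus differentiation is the adjoint of differentiation under the normal law.\<close>

lemma gauss_mean_hermite_Suc:
  "gauss_mean (hermite_poly (Suc q) * g) = gauss_mean (hermite_poly q * pderiv g)"
proof -
  have "hermite_poly (Suc q) * g = pCons 0 (hermite_poly q * g) - pderiv (hermite_poly q) * g"
    by (simp add: algebra_simps)
  then show ?thesis
    by (simp add: gauss_mean_diff gauss_mean_stein pderiv_mult gauss_mean_add mult.commute)
qed

text \<open>Orthogonality follows by moving both degrees down together: \<open>H\<^sub>q\<^sub>+\<^sub>1\<close> passes a derivative to
  \<open>H\<^sub>r\<^sub>+\<^sub>1\<close>, whose derivative is \<open>(r + 1) H\<^sub>r\<close>.\<close>

lemma gauss_mean_hermite_mult:
  "gauss_mean (hermite_poly q * hermite_poly r) = (if q = r then fact q else 0)"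
proof (induction q arbitrary: r)
  case 0
  show ?case
    using gauss_mean_hermite_Suc[of _ 1] by (cases r) (simp_all del: hermite_poly.simps(2))
next
  case (Suc q)
  show ?case
  proof (cases r)
    case 0
    then show ?thesis
      using gauss_mean_hermite_Suc[of q 1] by (simp del: hermite_poly.simps(2))
  next
    case (Suc s)
    then show ?thesis
      by (simp only: gauss_mean_hermite_Suc pderiv_hermite_poly_Suc mult_smult_right
          gauss_mean_smult Suc.IH) simp
  qed
qed

text \<open>Hermite polynomials are eigenfunctions of the Ornstein-Uhlenbeck semigroup:
  \<open>E (H\<^sub>q (a x + b Z)) = a\<^sup>q H\<^sub>q (x)\<close>. In the induction Stein's identity removes the factor \<open>Z\<close>, and
  \<open>1 - b\<^sup>2 = a\<^sup>2\<close> supplies the two extra powers of \<open>a\<close>.\<close>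

lemma gauss_mean_hermite_affine:
  assumes "a\<^sup>2 + b\<^sup>2 = 1"
  shows "gauss_mean (pcompose (hermite_poly q) [:a * x, b:]) = a ^ q * hermite q x"
proof (induction q x rule: hermite.induct)
  case (1 x)
  show ?case by (simp add: pcompose_1)
next
  case (2 x)
  have "pcompose (hermite_poly (Suc 0)) [:a * x, b:] = smult (a * x) 1 + pCons 0 [:b:]"
    by (simp add: pderiv_pCons pcompose_pCons pcompose_1)
  then show ?case
    by (simp only: gauss_mean_add gauss_mean_smult gauss_mean_stein) (simp add: pderiv_pCons)
next
  case (3 q x)
  let ?l = "[:a * x, b:]"
  let ?H = "\<lambda>q. pcompose (hermite_poly q) ?l"
  have "?H (Suc (Suc q)) = ?l * ?H (Suc q) - smult (real (Suc q)) (?H q)"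
    by (simp only: hermite_poly.simps(2)[of "Suc q"] pderiv_hermite_poly_Suc pcompose_diff
        pcompose_pCons pcompose_smult) simp
  also have "?l * ?H (Suc q) = smult (a * x) (?H (Suc q)) + smult b (pCons 0 (?H (Suc q)))"
    by simp
  finally have "?H (Suc (Suc q)) = smult (a * x) (?H (Suc q)) + smult b (pCons 0 (?H (Suc q)))
      - smult (real (Suc q)) (?H q)" .
  moreover have "pderiv (?H (Suc q)) = smult (b * real (Suc q)) (?H q)"
    by (simp only: pderiv_pcompose pderiv_hermite_poly_Suc pcompose_smult) (simp add: pderiv_pCons)
  ultimately have "gauss_mean (?H (Suc (Suc q))) =
      a * x * gauss_mean (?H (Suc q)) + b * (b * real (Suc q) * gauss_mean (?H q))
        - real (Suc q) * gauss_mean (?H q)"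
    by (simp only: gauss_mean_diff gauss_mean_add gauss_mean_smult gauss_mean_stein)
  also have "\<dots> = a * x * gauss_mean (?H (Suc q)) - (1 - b\<^sup>2) * real (Suc q) * gauss_mean (?H q)"
    by (simp add: algebra_simps power2_eq_square)
  also have "1 - b\<^sup>2 = a\<^sup>2"
    using assms by simp
  also have "a * x * gauss_mean (?H (Suc q)) - a\<^sup>2 * real (Suc q) * gauss_mean (?H q) =
      a ^ Suc (Suc q) * hermite (Suc (Suc q)) x"
    by (simp only: 3 hermite.simps(3)) (simp add: algebra_simps power2_eq_square)
  finally show ?case .
qed

section \<open>Hermite covariances of correlated normal variables\<close>

context prob_space
begin

lemma distr_std_normal:
  assumes "distributed M lborel W std_normal_density"
  shows "distr M borel W = std_normal"
proof -
  have "distr M borel W = distr M lborel W"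
    by (rule distr_cong) simp_all
  then show ?thesis
    using distributed_distr_eq_density[OF assms] by (simp add: std_normal_def)
qed

lemma std_normal_measurable:
  assumes "distributed M lborel W std_normal_density"
  shows "W \<in> borel_measurable M"
  using distributed_measurable[OF assms] by simp

lemma expectation_std_normal:
  fixes g :: "real \<Rightarrow> real"
  assumes "distributed M lborel W std_normal_density" and [measurable]: "g \<in> borel_measurable borel"
  shows "expectation (\<lambda>\<omega>. g (W \<omega>)) = (\<integral>x. g x \<partial>std_normal)"
  using std_normal_measurable[OF assms(1)]
  by (simp add: distr_std_normal[OF assms(1), symmetric] integral_distr)

lemma integrable_std_normal_iff:
  fixes g :: "real \<Rightarrow> real"
  assumes "distributed M lborel W std_normal_density" and [measurable]: "g \<in> borel_measurable borel"
  shows "integrable M (\<lambda>\<omega>. g (W \<omega>)) \<longleftrightarrow> integrable std_normal g"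
  using std_normal_measurable[OF assms(1)]
  by (simp add: distr_std_normal[OF assms(1), symmetric] integrable_distr_eq)

lemma integrable_hermite_mult:
  assumes U: "distributed M lborel U std_normal_density" and V: "distributed M lborel V std_normal_density"
  shows "integrable M (\<lambda>\<omega>. hermite q (U \<omega>) * hermite r (V \<omega>))"
proof -
  have sq: "integrable M (\<lambda>\<omega>. (hermite k (W \<omega>))\<^sup>2)"
    if "distributed M lborel W std_normal_density" for W k
  proof -
    have "integrable std_normal (\<lambda>x. poly (hermite_poly k ^ 2) x)"
      by (rule integrable_std_normal_poly)
    then show ?thesis
      by (subst integrable_std_normal_iff[OF that]) (simp_all add: poly_hermite_poly)
  qed
  have [measurable]: "U \<in> borel_measurable M" "V \<in> borel_measurable M"
    using U V by (auto intro: std_normal_measurable)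
  show ?thesis
  proof (rule Bochner_Integration.integrable_bound)
    show "integrable M (\<lambda>\<omega>. (hermite q (U \<omega>))\<^sup>2 + (hermite r (V \<omega>))\<^sup>2)"
      using sq[OF U] sq[OF V] by simp
    have "\<bar>x * y\<bar> \<le> x\<^sup>2 + y\<^sup>2" for x y :: real
    proof -
      have "2 * (\<bar>x\<bar> * \<bar>y\<bar>) \<le> x\<^sup>2 + y\<^sup>2"
        using sum_squares_bound[of "\<bar>x\<bar>" "\<bar>y\<bar>"] by (simp add: mult.assoc)
      moreover have "0 \<le> \<bar>x\<bar> * \<bar>y\<bar>"
        by simp
      ultimately show ?thesis
        unfolding abs_mult by linarith
    qed
    then show "AE \<omega> in M. norm (hermite q (U \<omega>) * hermite r (V \<omega>))
        \<le> norm ((hermite q (U \<omega>))\<^sup>2 + (hermite r (V \<omega>))\<^sup>2)"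
      by (intro AE_I2) simp
  qed simp
qed

lemma integrable_hermite:
  assumes "distributed M lborel U std_normal_density"
  shows "integrable M (\<lambda>\<omega>. hermite q (U \<omega>))"
  using integrable_hermite_mult[OF assms assms, of q 0] by simp

lemma expectation_hermite_mult:
  assumes "distributed M lborel W std_normal_density"
  shows "expectation (\<lambda>\<omega>. hermite q (W \<omega>) * hermite r (W \<omega>)) = (if q = r then fact q else 0)"
  unfolding gauss_mean_hermite_mult[symmetric] gauss_mean_def poly_mult poly_hermite_poly
  by (rule expectation_std_normal[OF assms]) simp

lemma expectation_hermite:
  assumes "distributed M lborel W std_normal_density" "0 < q"
  shows "expectation (\<lambda>\<omega>. hermite q (W \<omega>)) = 0"
  using expectation_hermite_mult[OF assms(1), of q 0] assms(2) by simp

lemma distributed_std_normal_affine: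
  assumes W: "distributed M lborel W std_normal_density"
    and V: "distributed M lborel V (normal_density 0 b)"
    and indep: "indep_var borel W borel V"
    and "0 < a" "0 < b" "a\<^sup>2 + b\<^sup>2 = 1"
  shows "distributed M lborel (\<lambda>\<omega>. a * W \<omega> + V \<omega>) std_normal_density"
proof -
  have "distributed M lborel (\<lambda>\<omega>. 0 + a * W \<omega>) (normal_density (0 + a * 0) (\<bar>a\<bar> * 1))"
    by (rule normal_density_affine[OF W]) (use \<open>0 < a\<close> in auto)
  then have aW: "distributed M lborel (\<lambda>\<omega>. a * W \<omega>) (normal_density 0 a)"
    using \<open>0 < a\<close> by simp
  have "indep_var borel ((\<lambda>x. a * x) \<circ> W) borel ((\<lambda>x. x) \<circ> V)"
    by (rule indep_var_compose[OF indep]) auto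
  then have "indep_var borel (\<lambda>\<omega>. a * W \<omega>) borel V"
    by (simp add: comp_def)
  from add_indep_normal[OF this _ _ aW V] show ?thesis
    using assms(4-) by simp
qed

text \<open>Conditioning on \<open>W\<close> (Fubini for the joint law, which is a product after \<open>V\<close> is standardised)
  reduces the covariance to the eigenfunction property and orthogonality.\<close>

lemma expectation_hermite_affine:
  assumes W: "distributed M lborel W std_normal_density"
    and V: "distributed M lborel V (normal_density 0 b)"
    and indep: "indep_var borel W borel V"
    and pos: "0 < a" "0 < b" and ab: "a\<^sup>2 + b\<^sup>2 = 1"
  shows "expectation (\<lambda>\<omega>. hermite q (a * W \<omega> + V \<omega>) * hermite q (W \<omega>)) = a ^ q * fact q"
proof -
  define \<xi> where "\<xi> = (\<lambda>\<omega>. V \<omega> / b)"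
  have V_eq: "V \<omega> = b * \<xi> \<omega>" for \<omega>
    using pos by (simp add: \<xi>_def)
  have \<xi>: "distributed M lborel \<xi> std_normal_density"
    using V normal_standard_normal_convert[OF pos(2), of V 0] by (simp add: \<xi>_def)
  have [measurable]: "W \<in> borel_measurable M" "\<xi> \<in> borel_measurable M"
    using W \<xi> by (auto intro: std_normal_measurable)
  have "indep_var borel ((\<lambda>x. x) \<circ> W) borel ((\<lambda>x. x / b) \<circ> V)"
    by (rule indep_var_compose[OF indep]) auto
  then have "indep_var borel W borel \<xi>"
    by (simp add: comp_def \<xi>_def)
  then have joint: "distr M (borel \<Otimes>\<^sub>M borel) (\<lambda>\<omega>. (W \<omega>, \<xi> \<omega>)) = std_normal \<Otimes>\<^sub>M std_normal"
    unfolding indep_var_distribution_eq by (simp add: distr_std_normal[OF W] distr_std_normal[OF \<xi>])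
  interpret pair: pair_prob_space std_normal std_normal ..
  define h where "h = (\<lambda>z. hermite q (a * fst z + b * snd z) * hermite q (fst z))"
  have h [measurable]: "h \<in> borel_measurable (borel \<Otimes>\<^sub>M borel)"
    unfolding h_def by measurable
  have hW: "hermite q (a * W \<omega> + V \<omega>) * hermite q (W \<omega>) = h (W \<omega>, \<xi> \<omega>)" for \<omega>
    by (simp add: h_def V_eq)
  have "integrable M (\<lambda>\<omega>. h (W \<omega>, \<xi> \<omega>))"
    using integrable_hermite_mult[OF distributed_std_normal_affine[OF assms] W, of q q]
    by (simp only: hW)
  then have int: "integrable (std_normal \<Otimes>\<^sub>M std_normal) h"
    unfolding joint[symmetric] by (subst integrable_distr_eq) auto
  have inner: "(\<integral>x. h (w, x) \<partial>std_normal) = a ^ q * (hermite q w)\<^sup>2" for w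
  proof -
    have "(\<integral>x. h (w, x) \<partial>std_normal) =
        gauss_mean (pcompose (hermite_poly q) [:a * w, b:]) * hermite q w"
      by (simp add: h_def gauss_mean_def poly_pcompose poly_hermite_poly mult.commute)
    then show ?thesis
      by (simp add: gauss_mean_hermite_affine[OF ab] power2_eq_square)
  qed
  have "expectation (\<lambda>\<omega>. h (W \<omega>, \<xi> \<omega>)) = (\<integral>z. h z \<partial>(std_normal \<Otimes>\<^sub>M std_normal))"
    unfolding joint[symmetric] by (subst integral_distr) auto
  also have "\<dots> = (\<integral>w. \<integral>x. h (w, x) \<partial>std_normal \<partial>std_normal)"
    by (rule pair.integral_fst'[OF int, symmetric])
  also have "\<dots> = a ^ q * gauss_mean (hermite_poly q * hermite_poly q)"
    by (simp add: inner gauss_mean_def poly_hermite_poly power2_eq_square)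
  finally show ?thesis
    by (simp add: hW gauss_mean_hermite_mult)
qed

lemma expectation_hermite_diff_sq:
  assumes W: "distributed M lborel W std_normal_density"
    and V: "distributed M lborel V (normal_density 0 b)"
    and indep: "indep_var borel W borel V"
    and pos: "0 < a" "0 < b" and ab: "a\<^sup>2 + b\<^sup>2 = 1"
  shows "expectation (\<lambda>\<omega>. (hermite q (a * W \<omega> + V \<omega>) - hermite q (W \<omega>))\<^sup>2) = 2 * fact q * (1 - a ^ q)"
proof -
  define U where "U = (\<lambda>\<omega>. a * W \<omega> + V \<omega>)"
  have U: "distributed M lborel U std_normal_density"
    unfolding U_def by (rule distributed_std_normal_affine[OF assms])
  have cov: "expectation (\<lambda>\<omega>. hermite q (U \<omega>) * hermite q (W \<omega>)) = a ^ q * fact q"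
    unfolding U_def by (rule expectation_hermite_affine[OF assms])
  have "expectation (\<lambda>\<omega>. (hermite q (U \<omega>) - hermite q (W \<omega>))\<^sup>2) =
      expectation (\<lambda>\<omega>. hermite q (U \<omega>) * hermite q (U \<omega>) + hermite q (W \<omega>) * hermite q (W \<omega>)
        - 2 * (hermite q (U \<omega>) * hermite q (W \<omega>)))"
    by (simp add: power2_eq_square algebra_simps)
  also have "\<dots> = 2 * fact q * (1 - a ^ q)"
    using integrable_hermite_mult[OF U U, of q q] integrable_hermite_mult[OF W W, of q q]
      integrable_hermite_mult[OF U W, of q q]
    by (simp add: expectation_hermite_mult[OF U] expectation_hermite_mult[OF W] cov) (simp add: algebra_simps)
  finally show ?thesis
    by (simp add: U_def)
qed

end

section \<open>The stationary autoregression\<close>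

lemma ar_unroll:
  fixes x e :: "nat \<Rightarrow> real"
  assumes "\<And>j. 1 \<le> j \<Longrightarrow> x j = a * x (j - 1) + s * e j"
  shows "x k = a ^ k * x 0 + (\<Sum>j=1..k. a ^ (k - j) * s * e j)"
proof (induction k)
  case (Suc k)
  have "(\<Sum>j=1..k. a ^ (Suc k - j) * s * e j) = a * (\<Sum>j=1..k. a ^ (k - j) * s * e j)"
    unfolding sum_distrib_left by (rule sum.cong) (simp_all add: Suc_diff_le)
  then show ?case
    using assms[of "Suc k"] by (simp add: Suc.IH algebra_simps)
qed simp

lemma ar_noise_variance:
  fixes a r :: real
  assumes "r\<^sup>2 = 1 - a\<^sup>2"
  shows "(\<Sum>j=1..k. (a ^ (k - j) * r)\<^sup>2) = 1 - (a ^ k)\<^sup>2"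
proof (induction k)
  case (Suc k)
  have "(\<Sum>j=1..Suc k. (a ^ (Suc k - j) * r)\<^sup>2) = (\<Sum>j=1..k. (a ^ (Suc k - j) * r)\<^sup>2) + r\<^sup>2"
    by simp
  also have "(\<Sum>j=1..k. (a ^ (Suc k - j) * r)\<^sup>2) = a\<^sup>2 * (\<Sum>j=1..k. (a ^ (k - j) * r)\<^sup>2)"
    unfolding sum_distrib_left by (rule sum.cong) (simp_all add: Suc_diff_le power_mult_distrib)
  finally show ?case
    unfolding Suc.IH assms by (simp add: algebra_simps power_mult_distrib)
qed simp

lemma distributed_cong_space:
  assumes "distributed M N U f" "\<And>\<omega>. \<omega> \<in> space M \<Longrightarrow> U \<omega> = V \<omega>"
  shows "distributed M N V f"
proof -
  have "distr M N V = distr M N U"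
    by (rule distr_cong) (simp_all add: assms(2))
  moreover have "V \<in> measurable M N"
    using measurable_cong[of M U V N] assms by (simp add: distributed_def)
  ultimately show ?thesis
    using assms(1) by (simp add: distributed_def)
qed

context prob_space
begin

text \<open>Unrolling the recursion expresses \<open>X\<^sub>k\<close> by \<open>X\<^sub>0\<close> and the innovations up to time \<open>k\<close>. The case
  \<open>k = 0\<close> is excluded because the noise would be degenerate there and have no density.\<close>

lemma stationary_ar_decomposition:
  fixes X \<epsilon> :: "nat \<Rightarrow> 'a \<Rightarrow> real"
  assumes a: "0 < a" "a < 1" and s: "0 < s" and d: "d = sqrt (s\<^sup>2 / (1 - a\<^sup>2))"
    and innovations: "\<And>j. 1 \<le> j \<Longrightarrow> distributed M lborel (\<epsilon> j) std_normal_density"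
    and indep: "indep_vars (\<lambda>_. borel) (\<lambda>j. if j = 0 then X 0 else \<epsilon> j) UNIV"
    and recursion: "\<And>j \<omega>. 1 \<le> j \<Longrightarrow> \<omega> \<in> space M \<Longrightarrow> X j \<omega> = a * X (j - 1) \<omega> + s * \<epsilon> j \<omega>"
    and k: "0 < k"
  obtains V where "distributed M lborel V (normal_density 0 (sqrt (1 - (a ^ k)\<^sup>2)))"
    and "indep_var borel (\<lambda>\<omega>. X 0 \<omega> / d) borel V"
    and "\<And>\<omega>. \<omega> \<in> space M \<Longrightarrow> X k \<omega> / d = a ^ k * (X 0 \<omega> / d) + V \<omega>"
proof
  define r where "r = sqrt (1 - a\<^sup>2)"
  have "a\<^sup>2 < 1"
    using a by (simp add: power2_eq_square) (smt (verit) mult_le_cancel_left1)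
  then have r: "r > 0" "d = s / r"
    using s by (simp_all add: r_def d real_sqrt_divide)
  define Y where "Y = (\<lambda>j \<omega>. if j = 0 then X 0 \<omega> / d else a ^ (k - j) * r * \<epsilon> j \<omega>)"
  define V where "V = (\<lambda>\<omega>. \<Sum>j\<in>{1..k}. Y j \<omega>)"
  have "indep_vars (\<lambda>_. borel) (\<lambda>j \<omega>. (if j = 0 then (\<lambda>x. x / d) else (\<lambda>x. a ^ (k - j) * r * x))
      ((if j = 0 then X 0 else \<epsilon> j) \<omega>)) UNIV"
    by (rule indep_vars_compose2[OF indep]) auto
  also have "(\<lambda>j \<omega>. (if j = 0 then (\<lambda>x. x / d) else (\<lambda>x. a ^ (k - j) * r * x))
      ((if j = 0 then X 0 else \<epsilon> j) \<omega>)) = Y"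
    by (auto simp: Y_def fun_eq_iff)
  finally have Y: "indep_vars (\<lambda>_. borel) Y UNIV" .
  have "indep_var borel (Y 0) borel V"
    unfolding V_def by (rule indep_vars_sum) (auto intro: indep_vars_subset[OF Y])
  then show "indep_var borel (\<lambda>\<omega>. X 0 \<omega> / d) borel V"
    by (simp add: Y_def)
  have "distributed M lborel V (normal_density (\<Sum>j\<in>{1..k}. 0) (sqrt (\<Sum>j\<in>{1..k}. (a ^ (k - j) * r)\<^sup>2)))"
    unfolding V_def
  proof (rule sum_indep_normal)
    show "indep_vars (\<lambda>_. borel) Y {1..k}"
      by (rule indep_vars_subset[OF Y]) simp
    fix j assume j: "j \<in> {1..k}"
    show pos: "0 < a ^ (k - j) * r"
      using a r by simp
    have "distributed M lborel (\<lambda>\<omega>. 0 + (a ^ (k - j) * r) * \<epsilon> j \<omega>)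
        (normal_density (0 + (a ^ (k - j) * r) * 0) (\<bar>a ^ (k - j) * r\<bar> * 1))"
      by (rule normal_density_affine[OF innovations]) (use j a r in auto)
    moreover have "\<bar>a ^ (k - j) * r\<bar> * 1 = a ^ (k - j) * r"
      using pos by simp
    ultimately show "distributed M lborel (Y j) (normal_density 0 (a ^ (k - j) * r))"
      using j by (simp add: Y_def)
  qed (use k in auto)
  then show "distributed M lborel V (normal_density 0 (sqrt (1 - (a ^ k)\<^sup>2)))"
    using ar_noise_variance[of r a k] \<open>a\<^sup>2 < 1\<close> by (simp add: r_def)
  fix \<omega> assume "\<omega> \<in> space M"
  then have "X k \<omega> = a ^ k * X 0 \<omega> + (\<Sum>j=1..k. a ^ (k - j) * s * \<epsilon> j \<omega>)"
    by (intro ar_unroll[of "\<lambda>j. X j \<omega>" a s "\<lambda>j. \<epsilon> j \<omega>"] recursion)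
  moreover have "V \<omega> = (\<Sum>j=1..k. a ^ (k - j) * s * \<epsilon> j \<omega>) / d"
    unfolding V_def sum_divide_distrib
    by (rule sum.cong) (use s r in \<open>auto simp: Y_def\<close>)
  ultimately show "X k \<omega> / d = a ^ k * (X 0 \<omega> / d) + V \<omega>"
    by (simp add: add_divide_distrib)
qed

lemma stationary_ar_hermite:
  fixes X \<epsilon> :: "nat \<Rightarrow> 'a \<Rightarrow> real"
  assumes a: "0 < a" "a < 1" and s: "0 < s" and d: "d = sqrt (s\<^sup>2 / (1 - a\<^sup>2))"
    and innovations: "\<And>j. 1 \<le> j \<Longrightarrow> distributed M lborel (\<epsilon> j) std_normal_density"
    and initial: "distributed M lborel (X 0) (normal_density 0 d)"
    and indep: "indep_vars (\<lambda>_. borel) (\<lambda>j. if j = 0 then X 0 else \<epsilon> j) UNIV"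
    and recursion: "\<And>j \<omega>. 1 \<le> j \<Longrightarrow> \<omega> \<in> space M \<Longrightarrow> X j \<omega> = a * X (j - 1) \<omega> + s * \<epsilon> j \<omega>"
  shows "distributed M lborel (\<lambda>\<omega>. X k \<omega> / d) std_normal_density"
    and "expectation (\<lambda>\<omega>. (hermite q (X k \<omega> / d) - hermite q (X 0 \<omega> / d))\<^sup>2) = 2 * fact q * (1 - a ^ (k * q))"
proof -
  have a2: "a\<^sup>2 < 1"
    using a by (simp add: power2_eq_square) (smt (verit) mult_le_cancel_left1)
  then have "d > 0"
    using s by (simp add: d)
  then have W: "distributed M lborel (\<lambda>\<omega>. X 0 \<omega> / d) std_normal_density"
    using normal_standard_normal_convert[of d "X 0" 0] initial by simp
  have "distributed M lborel (\<lambda>\<omega>. X k \<omega> / d) std_normal_density \<and>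
     expectation (\<lambda>\<omega>. (hermite q (X k \<omega> / d) - hermite q (X 0 \<omega> / d))\<^sup>2) = 2 * fact q * (1 - a ^ (k * q))"
  proof (cases "k = 0")
    case True
    then show ?thesis using W by simp
  next
    case False
    then obtain V where V: "distributed M lborel V (normal_density 0 (sqrt (1 - (a ^ k)\<^sup>2)))"
      "indep_var borel (\<lambda>\<omega>. X 0 \<omega> / d) borel V"
      "\<And>\<omega>. \<omega> \<in> space M \<Longrightarrow> X k \<omega> / d = a ^ k * (X 0 \<omega> / d) + V \<omega>"
      using stationary_ar_decomposition[OF a s d innovations indep recursion] by blast
    have "a ^ k < 1" "0 < a ^ k"
      using a False by (simp_all add: power_less_one_iff)
    then have ak: "(a ^ k)\<^sup>2 < 1"
      by (simp add: power2_eq_square) (smt (verit) mult_le_cancel_left1)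
    have pos: "0 < sqrt (1 - (a ^ k)\<^sup>2)" and one: "(a ^ k)\<^sup>2 + (sqrt (1 - (a ^ k)\<^sup>2))\<^sup>2 = 1"
      using ak by simp_all
    have "distributed M lborel (\<lambda>\<omega>. X k \<omega> / d) std_normal_density"
      by (rule distributed_cong_space[OF distributed_std_normal_affine[OF W V(1,2) \<open>0 < a ^ k\<close> pos one]])
        (simp add: V(3))
    moreover have "expectation (\<lambda>\<omega>. (hermite q (X k \<omega> / d) - hermite q (X 0 \<omega> / d))\<^sup>2) =
        expectation (\<lambda>\<omega>. (hermite q (a ^ k * (X 0 \<omega> / d) + V \<omega>) - hermite q (X 0 \<omega> / d))\<^sup>2)"
      by (rule Bochner_Integration.integral_cong) (simp_all only: V(3))
    ultimately show ?thesis
      using expectation_hermite_diff_sq[OF W V(1,2) \<open>0 < a ^ k\<close> pos one, of q]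
      by (simp add: power_mult)
  qed
  then show "distributed M lborel (\<lambda>\<omega>. X k \<omega> / d) std_normal_density"
    and "expectation (\<lambda>\<omega>. (hermite q (X k \<omega> / d) - hermite q (X 0 \<omega> / d))\<^sup>2) = 2 * fact q * (1 - a ^ (k * q))"
    by blast+
qed

end

section \<open>Lines and step functions in the Skorokhod space\<close>

text \<open>The identity is an admissible time change.\<close>

lemma skorokhod_dist_le_uniform:
  assumes "x \<in> cadlag" "y \<in> cadlag" "0 < r" and close: "\<And>t. t \<in> {0..1} \<Longrightarrow> \<bar>x t - y t\<bar> \<le> r"
  shows "skorokhod_dist x y \<le> r"
proof -
  have "skorokhod_within r x y"
    unfolding skorokhod_within_def using assms(3) close
    by (intro conjI bexI[OF _ time_changes_id]) auto
  then have "skorokhod_dist x y < r + e" if "e > 0" for e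
    using that skorokhod_dist_less_iff[OF assms(1,2)] by (metis less_add_same_cancel1)
  then show ?thesis
    by (meson field_le_epsilon less_imp_le)
qed

lemma borel_measurable_continuous_map:
  assumes "continuous_map T euclideanreal h"
  shows "h \<in> borel_measurable (borel_sets_of T)"
proof (rule borel_measurableI)
  fix S :: "real set" assume "open S"
  then have "openin T {x \<in> topspace T. h x \<in> S}"
    using assms by (simp add: continuous_map_def)
  moreover have "{U. openin T U} \<subseteq> Pow (topspace T)"
    using openin_subset by blast
  moreover have "h -` S \<inter> space (borel_sets_of T) = {x \<in> topspace T. h x \<in> S}"
    by (auto simp: borel_sets_of_def space_measure_of_conv)
  ultimately show "h -` S \<inter> space (borel_sets_of T) \<in> sets (borel_sets_of T)"
    by (auto simp: borel_sets_of_def)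
qed

text \<open>A family of paths that depends on its
  parameter continuously in the uniform sense is continuous into the coarser Skorokhod topology,
  hence Borel.\<close>

lemma measurable_skorokhod:
  fixes \<Phi> :: "'c::topological_space \<Rightarrow> real \<Rightarrow> real"
  assumes cadlag: "\<And>v. \<Phi> v \<in> cadlag"
    and cont: "\<And>v r. 0 < r \<Longrightarrow> \<forall>\<^sub>F w in nhds v. \<forall>t\<in>{0..1}. \<bar>\<Phi> v t - \<Phi> w t\<bar> \<le> r"
  shows "\<Phi> \<in> measurable borel (borel_sets_of skorokhod_topology)"
  unfolding borel_sets_of_def
proof (rule measurable_measure_of)
  show "{U. openin skorokhod_topology U} \<subseteq> Pow (topspace skorokhod_topology)"
    using openin_subset by blast
  show "\<Phi> \<in> space borel \<rightarrow> topspace skorokhod_topology"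
    using cadlag by simp
  fix U assume "U \<in> {U. openin skorokhod_topology U}"
  then have U: "openin skorokhod_topology U" by simp
  have "open (\<Phi> -` U)"
    unfolding open_subopen[of "\<Phi> -` U"]
  proof
    fix v assume "v \<in> \<Phi> -` U"
    then obtain r where r: "r > 0" "skorokhod.mball (\<Phi> v) r \<subseteq> U"
      using U by (auto simp: skorokhod.openin_mtopology)
    have "\<forall>\<^sub>F w in nhds v. \<forall>t\<in>{0..1}. \<bar>\<Phi> v t - \<Phi> w t\<bar> \<le> r / 2"
      by (rule cont) (use r in simp)
    then obtain S where S: "open S" "v \<in> S" "\<And>w. w \<in> S \<Longrightarrow> \<forall>t\<in>{0..1}. \<bar>\<Phi> v t - \<Phi> w t\<bar> \<le> r / 2"
      by (auto simp: eventually_nhds)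
    have "\<Phi> w \<in> U" if "w \<in> S" for w
    proof -
      have "skorokhod_dist (\<Phi> v) (\<Phi> w) \<le> r / 2"
        using S(3)[OF that] r by (intro skorokhod_dist_le_uniform cadlag) auto
      then show ?thesis
        using r cadlag by (auto simp: subset_iff)
    qed
    then show "\<exists>T. open T \<and> v \<in> T \<and> T \<subseteq> \<Phi> -` U"
      using S by blast
  qed
  then show "\<Phi> -` U \<inter> space borel \<in> sets borel"
    by simp
qed

definition ray :: "real \<Rightarrow> real \<Rightarrow> real" where
  "ray g = (\<lambda>t\<in>{0..1}. t * g)"

text \<open>Partial-sum processes depend on \<open>t\<close> only through \<open>\<lfloor>n t\<rfloor>\<close>, hence are images of a random sequence
  under \<open>step_path n\<close>; this is how they become random elements of the Skorokhod space.\<close>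

definition step_path :: "nat \<Rightarrow> (nat \<Rightarrow> real) \<Rightarrow> real \<Rightarrow> real" where
  "step_path n v = (\<lambda>t\<in>{0..1}. v (nat \<lfloor>real n * t\<rfloor>))"

lemma continuous_cadlag:
  assumes "continuous_on {0..1} f"
  shows "restrict f {0..1} \<in> cadlag"
proof -
  have lim: "(restrict f {0..1} \<longlongrightarrow> f t) (at t within S)" if "S \<subseteq> {0..1}" "t \<in> {0..1}" for t S
  proof (rule Lim_transform_eventually)
    show "(f \<longlongrightarrow> f t) (at t within S)"
      using assms that by (auto simp: continuous_on_def intro: tendsto_within_subset)
    show "\<forall>\<^sub>F s in at t within S. f s = restrict f {0..1} s"
      unfolding eventually_at_filter using that by (intro always_eventually) auto
  qed
  have right: "(restrict f {0..1} \<longlongrightarrow> f t) (at_right t)" if t: "t \<in> {0..<1}" for t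
  proof -
    have "(restrict f {0..1} \<longlongrightarrow> f t) (at t within {t..1})"
      by (rule lim) (use t in auto)
    moreover have "at t within {t..1} = at_right t"
      by (rule at_within_Icc_at_right) (use t in simp)
    ultimately show ?thesis by metis
  qed
  have left: "(restrict f {0..1} \<longlongrightarrow> f t) (at_left t)" if t: "t \<in> {0<..1}" for t
  proof -
    have "(restrict f {0..1} \<longlongrightarrow> f t) (at t within {0..t})"
      by (rule lim) (use t in auto)
    moreover have "at t within {0..t} = at_left t"
      by (rule at_within_Icc_at_left) (use t in simp)
    ultimately show ?thesis by metis
  qed
  show ?thesis
    unfolding cadlag_def
  proof (intro CollectI conjI ballI)
    fix t :: real
    show "(restrict f {0..1} \<longlongrightarrow> restrict f {0..1} t) (at_right t)" if "t \<in> {0..<1}"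
      using right[OF that] that by simp
    show "\<exists>l. (restrict f {0..1} \<longlongrightarrow> l) (at_left t)" if "t \<in> {0<..1}"
      using left[OF that] by blast
  qed simp
qed

lemma ray_cadlag: "ray g \<in> cadlag"
  unfolding ray_def by (intro continuous_cadlag continuous_intros)

lemma floor_index_le: "nat \<lfloor>real n * t\<rfloor> \<le> n" if "t \<in> {0..1}"
proof -
  have "real n * t \<le> real n"
    using that by (simp add: mult_left_le)
  then show ?thesis by linarith
qed

lemma step_path_cadlag: "step_path n v \<in> cadlag"
proof (cases "n = 0")
  case True
  then have "step_path n v = (\<lambda>t\<in>{0..1}. v 0)"
    by (simp add: step_path_def)
  then show ?thesis
    by (simp add: continuous_cadlag)
next
  case False
  then have n: "real n > 0" by simp
  have right: "(step_path n v \<longlongrightarrow> step_path n v t) (at_right t)" if t: "t \<in> {0..<1}" for t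
  proof (rule tendsto_eventually)
    define j where "j = \<lfloor>real n * t\<rfloor>"
    have "t < (of_int j + 1) / real n"
      using n by (simp add: j_def pos_less_divide_eq mult.commute) 
    then have ev: "\<forall>\<^sub>F s in at_right t. s \<in> {t<..<min 1 ((of_int j + 1) / real n)}"
      using t by (intro eventually_at_right_real) auto
    show "\<forall>\<^sub>F s in at_right t. step_path n v s = step_path n v t"
      using ev
    proof eventually_elim
      case (elim s)
      have "real n * t \<le> real n * s" "real n * s < of_int j + 1"
        using elim n by (auto simp: pos_less_divide_eq mult.commute)
      then have "\<lfloor>real n * s\<rfloor> = j"
        unfolding floor_eq_iff j_def by linarith
      then show ?case
        using elim t by (simp add: step_path_def j_def)
    qed
  qed
  have left: "(step_path n v \<longlongrightarrow> v (nat (\<lceil>real n * t\<rceil> - 1))) (at_left t)" if t: "t \<in> {0<..1}" for t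
  proof (rule tendsto_eventually)
    define j where "j = \<lceil>real n * t\<rceil> - 1"
    have "of_int j / real n < t"
      using n unfolding j_def by (simp add: pos_divide_less_eq mult.commute) linarith
    then have ev: "\<forall>\<^sub>F s in at_left t. s \<in> {max 0 (of_int j / real n)<..<t}"
      using t by (intro eventually_at_left_real) auto
    show "\<forall>\<^sub>F s in at_left t. step_path n v s = v (nat j)"
      using ev
    proof eventually_elim
      case (elim s)
      have "of_int j < real n * s" "real n * s < real n * t"
        using elim n by (auto simp: pos_divide_less_eq mult.commute)
      then have "\<lfloor>real n * s\<rfloor> = j"
        unfolding floor_eq_iff j_def by linarith
      then show ?case
        using elim t by (simp add: step_path_def)
    qed
  qed
  show ?thesis
    unfolding cadlag_def
  proof (intro CollectI conjI ballI)
    show "step_path n v \<in> extensional {0..1}"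
      by (simp add: step_path_def)
    show "\<exists>l. (step_path n v \<longlongrightarrow> l) (at_left t)" if "t \<in> {0<..1}" for t
      using left[OF that] by blast
  qed (rule right)
qed

lemma measurable_ray: "ray \<in> measurable borel (borel_sets_of skorokhod_topology)"
proof (rule measurable_skorokhod)
  fix g r :: real assume "0 < r"
  then have "\<forall>\<^sub>F g' in nhds g. dist g' g < r"
    by (auto simp: eventually_nhds_metric)
  then show "\<forall>\<^sub>F g' in nhds g. \<forall>t\<in>{0..1}. \<bar>ray g t - ray g' t\<bar> \<le> r"
  proof eventually_elim
    case (elim g')
    have "\<bar>t * g - t * g'\<bar> \<le> r" if "t \<in> {0..1}" for t
    proof -
      have "\<bar>t * g - t * g'\<bar> = t * \<bar>g - g'\<bar>"
        using that by (simp add: right_diff_distrib[symmetric] abs_mult)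
      also have "\<dots> \<le> 1 * \<bar>g - g'\<bar>"
        using that by (intro mult_right_mono) auto
      finally show ?thesis
        using elim by (simp add: dist_real_def)
    qed
    then show ?case by (simp add: ray_def)
  qed
qed (rule ray_cadlag)

lemma measurable_step_path: "step_path n \<in> measurable borel (borel_sets_of skorokhod_topology)"
proof (rule measurable_skorokhod)
  fix v :: "nat \<Rightarrow> real" and r :: real assume r: "0 < r"
  have "\<forall>\<^sub>F w in nhds v. \<bar>v i - w i\<bar> \<le> r" for i
  proof -
    have "open ((\<lambda>w :: nat \<Rightarrow> real. w i) -` ball (v i) r)"
      by (intro open_vimage continuous_on_product_coordinates open_ball)
    then have "\<forall>\<^sub>F w in nhds v. w \<in> (\<lambda>w. w i) -` ball (v i) r"
      using r by (intro eventually_nhds_in_open) auto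
    then show ?thesis
      by eventually_elim (simp add: dist_real_def)
  qed
  then have "\<forall>\<^sub>F w in nhds v. \<forall>i\<in>{..n}. \<bar>v i - w i\<bar> \<le> r"
    by (intro eventually_ball_finite) auto
  then show "\<forall>\<^sub>F w in nhds v. \<forall>t\<in>{0..1}. \<bar>step_path n v t - step_path n w t\<bar> \<le> r"
  proof eventually_elim
    case (elim w)
    then show ?case
      by (simp add: step_path_def floor_index_le)
  qed
qed (rule step_path_cadlag)

text \<open>A continuous functional is uniformly continuous near a compact set. Here the compact set
  consists of the rays with slope in \<open>[-K, K]\<close>; a finite cover of that interval of slopes gives
  the common radius.\<close>

lemma continuous_near_rays:
  assumes h: "continuous_map skorokhod_topology euclideanreal h" and e: "0 < e"
  obtains d where "0 < d"
    and "\<And>g y. \<bar>g\<bar> \<le> K \<Longrightarrow> y \<in> cadlag \<Longrightarrow> skorokhod_dist (ray g) y < d \<Longrightarrow> \<bar>h (ray g) - h y\<bar> < e"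
proof -
  have "\<exists>r>0. \<forall>y\<in>cadlag. skorokhod_dist (ray g) y < r \<longrightarrow> \<bar>h (ray g) - h y\<bar> < e / 2" for g
  proof -
    have "openin skorokhod_topology {x \<in> cadlag. h x \<in> ball (h (ray g)) (e / 2)}"
      using h open_ball[of "h (ray g)" "e / 2"]
      by (simp only: continuous_map_def skorokhod.topspace_mtopology open_openin)
    moreover have "ray g \<in> {x \<in> cadlag. h x \<in> ball (h (ray g)) (e / 2)}"
      using e by (simp add: ray_cadlag)
    ultimately obtain r where "r > 0" "skorokhod.mball (ray g) r \<subseteq> {x \<in> cadlag. h x \<in> ball (h (ray g)) (e / 2)}"
      unfolding skorokhod.openin_mtopology by blast
    then show ?thesis
      by (intro exI[of _ r]) (auto simp: subset_iff ray_cadlag dist_real_def)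
  qed
  then obtain r where r: "\<And>g. r g > 0"
    "\<And>g y. y \<in> cadlag \<Longrightarrow> skorokhod_dist (ray g) y < r g \<Longrightarrow> \<bar>h (ray g) - h y\<bar> < e / 2"
    by metis
  have cover: "{-K..K} \<subseteq> (\<Union>g\<in>{-K..K}. ball g (r g / 2))"
    using r(1) by force
  obtain C where C: "C \<subseteq> {-K..K}" "finite C" "{-K..K} \<subseteq> (\<Union>g\<in>C. ball g (r g / 2))"
    using compactE_image[OF compact_Icc _ cover] open_ball by metis
  define d where "d = Min (insert 1 ((\<lambda>g. r g / 2) ` C))"
  show thesis
  proof
    show "0 < d"
      using C r(1) by (auto simp: d_def)
    fix g y assume g: "\<bar>g\<bar> \<le> K" and y: "y \<in> cadlag" "skorokhod_dist (ray g) y < d"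
    obtain g0 where g0: "g0 \<in> C" "\<bar>g0 - g\<bar> < r g0 / 2"
    proof -
      have "g \<in> {-K..K}"
        using g by auto
      then have "g \<in> (\<Union>g\<in>C. ball g (r g / 2))"
        using C(3) by blast
      then show thesis
        using that by (auto simp: dist_real_def)
    qed
    have d: "d \<le> r g0 / 2"
      using g0 C unfolding d_def by (intro Min_le) auto
    have "\<bar>ray g0 t - ray g t\<bar> \<le> max \<bar>g0 - g\<bar> (r g0 / 4)" if "t \<in> {0..1}" for t
    proof -
      have "\<bar>t * g0 - t * g\<bar> = t * \<bar>g0 - g\<bar>"
        using that by (simp add: right_diff_distrib[symmetric] abs_mult)
      also have "\<dots> \<le> 1 * \<bar>g0 - g\<bar>"
        using that by (intro mult_right_mono) auto
      finally show ?thesis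
        using that by (simp add: ray_def)
    qed
    then have "skorokhod_dist (ray g0) (ray g) \<le> max \<bar>g0 - g\<bar> (r g0 / 4)"
      using r(1)[of g0] by (intro skorokhod_dist_le_uniform ray_cadlag) auto
    also have "max \<bar>g0 - g\<bar> (r g0 / 4) < r g0 / 2"
      using g0 r(1)[of g0] by simp
    finally have near: "skorokhod_dist (ray g0) (ray g) < r g0 / 2" .
    then have "skorokhod_dist (ray g0) y < r g0"
      using skorokhod.triangle[OF ray_cadlag ray_cadlag y(1), of g0 g] y(2) d by linarith
    then have "\<bar>h (ray g0) - h y\<bar> < e / 2"
      using r(2) y by blast
    moreover have "\<bar>h (ray g0) - h (ray g)\<bar> < e / 2"
      using near r(1)[of g0] by (intro r(2) ray_cadlag) linarith
    ultimately show "\<bar>h (ray g) - h y\<bar> < e"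
      by linarith
  qed
qed

text \<open>A Slutsky argument whose limit lives on rays. A bounded continuous \<open>h\<close> changes by little between
  \<open>Y n\<close> and the ray of slope \<open>G n\<close> unless \<open>\<bar>G n\<bar> > K\<close> or \<open>D n > d / 2\<close>; the indicators of these
  events are dominated by \<open>\<bar>G n\<bar> / K\<close> and \<open>2 D n / d\<close>, so that a pointwise bound can be integrated
  at once. Since all \<open>G n\<close> share the law of \<open>G\<^sub>0\<close>, rays of slope \<open>G n\<close> already have the limit law.\<close>

lemma converges_in_distribution_ray:
  fixes M :: "'a measure" and N :: "'b measure"
    and Y :: "nat \<Rightarrow> 'a \<Rightarrow> real \<Rightarrow> real" and G D :: "nat \<Rightarrow> 'a \<Rightarrow> real" and G\<^sub>0 :: "'b \<Rightarrow> real"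
  assumes M: "prob_space M" and N: "prob_space N"
    and Y: "\<And>n. Y n \<in> measurable M (borel_sets_of skorokhod_topology)"
    and G\<^sub>0: "integrable N G\<^sub>0"
    and G: "\<And>n. 1 \<le> n \<Longrightarrow> G n \<in> borel_measurable M"
    and law: "\<And>n. 1 \<le> n \<Longrightarrow> distr M borel (G n) = distr N borel G\<^sub>0"
    and D: "\<And>n. 1 \<le> n \<Longrightarrow> integrable M (D n)"
    and close: "\<And>n \<omega> t. 1 \<le> n \<Longrightarrow> \<omega> \<in> space M \<Longrightarrow> t \<in> {0..1} \<Longrightarrow> \<bar>Y n \<omega> t - t * G n \<omega>\<bar> \<le> D n \<omega>"
    and lim: "(\<lambda>n. \<integral>\<omega>. D n \<omega> \<partial>M) \<longlonglongrightarrow> 0"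
  shows "converges_in_distribution skorokhod_topology M Y N (\<lambda>\<omega>. ray (G\<^sub>0 \<omega>))"
  unfolding converges_in_distribution_def
proof (intro conjI allI impI Y)
  interpret M: prob_space M by (rule M)
  interpret N: prob_space N by (rule N)
  let ?S = "borel_sets_of skorokhod_topology"
  have G\<^sub>0_meas [measurable]: "G\<^sub>0 \<in> borel_measurable N"
    using G\<^sub>0 by simp
  show "(\<lambda>\<omega>. ray (G\<^sub>0 \<omega>)) \<in> measurable N ?S"
    by (rule measurable_compose[OF G\<^sub>0_meas measurable_ray])
  fix h assume "continuous_map skorokhod_topology euclideanreal h \<and> bounded (h ` topspace skorokhod_topology)"
  then have h: "continuous_map skorokhod_topology euclideanreal h" and "bounded (h ` cadlag)"
    by auto
  then obtain B where B: "B > 0" "\<And>x. x \<in> cadlag \<Longrightarrow> \<bar>h x\<bar> \<le> B"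
    unfolding bounded_pos by (metis image_eqI real_norm_def)
  have h_meas [measurable]: "h \<in> borel_measurable ?S"
    by (rule borel_measurable_continuous_map[OF h])
  have hray [measurable]: "(\<lambda>x. h (ray x)) \<in> borel_measurable borel"
    by (rule measurable_compose[OF measurable_ray h_meas])
  have cadlag: "Y n \<omega> \<in> cadlag" if "\<omega> \<in> space M" for n \<omega>
    using measurable_space[OF Y that, of n] by (simp add: borel_sets_of_def space_measure_of_conv)
  have hY: "integrable M (\<lambda>\<omega>. h (Y n \<omega>))" for n
    using measurable_compose[OF Y h_meas] B(2) cadlag
    by (intro M.integrable_const_bound[of _ B] AE_I2) auto
  have hG: "integrable M (\<lambda>\<omega>. h (ray (G n \<omega>)))" if "1 \<le> n" for n
    using measurable_compose[OF G[OF that] hray] B(2) ray_cadlag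
    by (intro M.integrable_const_bound[of _ B] AE_I2) auto
  define C where "C = (\<integral>\<omega>. \<bar>G\<^sub>0 \<omega>\<bar> \<partial>N)"
  have "C \<ge> 0"
    by (simp add: C_def)
  have transfer: "(\<integral>\<omega>. u (G n \<omega>) \<partial>M) = (\<integral>\<omega>. u (G\<^sub>0 \<omega>) \<partial>N)"
    if "1 \<le> n" and [measurable]: "u \<in> borel_measurable borel" for n and u :: "real \<Rightarrow> real"
    using integral_distr[OF G[OF that(1)] that(2)] integral_distr[OF G\<^sub>0_meas that(2)] law[OF that(1)]
    by simp
  have absG: "integrable M (\<lambda>\<omega>. \<bar>G n \<omega>\<bar>)" if n: "1 \<le> n" for n
  proof -
    have "integrable (distr N borel G\<^sub>0) (\<lambda>x. \<bar>x\<bar>)"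
      using G\<^sub>0 by (subst integrable_distr_eq) auto
    then show ?thesis
      unfolding law[OF n, symmetric] using G[OF n] by (subst (asm) integrable_distr_eq) auto
  qed
  show "(\<lambda>n. \<integral>\<omega>. h (Y n \<omega>) \<partial>M) \<longlonglongrightarrow> (\<integral>\<omega>. h (ray (G\<^sub>0 \<omega>)) \<partial>N)"
  proof (rule LIMSEQ_I)
    fix e :: real assume e: "0 < e"
    \<comment> \<open>The summand 1 keeps \<open>K\<close> positive when \<open>C = 0\<close>.\<close>
    define K where "K = 6 * B * C / e + 1"
    have K: "K > 0" "2 * B * (C / K) < e / 3"
    proof -
      show "K > 0"
        using B \<open>C \<ge> 0\<close> e by (simp add: K_def add_nonneg_pos)
      have "6 * B * C < e * K"
        using e by (simp add: K_def algebra_simps)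
      then show "2 * B * (C / K) < e / 3"
        using \<open>K > 0\<close> by (simp add: field_simps)
    qed
    obtain d where d: "0 < d"
      "\<And>g y. \<bar>g\<bar> \<le> K \<Longrightarrow> y \<in> cadlag \<Longrightarrow> skorokhod_dist (ray g) y < d \<Longrightarrow> \<bar>h (ray g) - h y\<bar> < e / 3"
      using continuous_near_rays[OF h, of "e / 3" K] e by auto
    have pointwise: "\<bar>h (ray (G n \<omega>)) - h (Y n \<omega>)\<bar> \<le> e / 3 + 2 * B * (\<bar>G n \<omega>\<bar> / K + D n \<omega> * (2 / d))"
      if n: "1 \<le> n" and \<omega>: "\<omega> \<in> space M" for n \<omega>
    proof -
      have D0: "0 \<le> D n \<omega>"
        using close[OF n \<omega>, of 0] by simp
      then have nonneg: "0 \<le> \<bar>G n \<omega>\<bar> / K" "0 \<le> D n \<omega> * (2 / d)"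
        using K d by simp_all
      show ?thesis
      proof (cases "\<bar>G n \<omega>\<bar> \<le> K \<and> D n \<omega> \<le> d / 2")
        case True
        have "skorokhod_dist (ray (G n \<omega>)) (Y n \<omega>) \<le> d / 2"
        proof (rule skorokhod_dist_le_uniform[OF ray_cadlag cadlag[OF \<omega>]])
          fix t :: real assume t: "t \<in> {0..1}"
          show "\<bar>ray (G n \<omega>) t - Y n \<omega> t\<bar> \<le> d / 2"
            using close[OF n \<omega> t] True t by (simp add: ray_def abs_minus_commute)
        qed (use d in simp)
        then have "\<bar>h (ray (G n \<omega>)) - h (Y n \<omega>)\<bar> < e / 3"
          using d(1) True by (intro d(2) cadlag[OF \<omega>]) auto
        moreover have "0 \<le> 2 * B * (\<bar>G n \<omega>\<bar> / K + D n \<omega> * (2 / d))"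
          using nonneg B by simp
        ultimately show ?thesis by linarith
      next
        case False
        then have "1 \<le> \<bar>G n \<omega>\<bar> / K \<or> 1 \<le> D n \<omega> * (2 / d)"
          using K(1) d(1) by (auto simp: field_simps)
        then have "1 \<le> \<bar>G n \<omega>\<bar> / K + D n \<omega> * (2 / d)"
          using nonneg by linarith
        then have "2 * B * 1 \<le> 2 * B * (\<bar>G n \<omega>\<bar> / K + D n \<omega> * (2 / d))"
          using B by (intro mult_left_mono) auto
        moreover have "\<bar>h (ray (G n \<omega>)) - h (Y n \<omega>)\<bar> \<le> 2 * B"
          using B(2)[OF ray_cadlag, of "G n \<omega>"] B(2)[OF cadlag[OF \<omega>], of n] by linarith
        ultimately show ?thesis
          using e by linarith
      qed
    qed
    have bound: "\<bar>(\<integral>\<omega>. h (Y n \<omega>) \<partial>M) - (\<integral>\<omega>. h (ray (G\<^sub>0 \<omega>)) \<partial>N)\<bar>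
        \<le> e / 3 + 2 * B * (C / K + (\<integral>\<omega>. D n \<omega> \<partial>M) * (2 / d))" if n: "1 \<le> n" for n
    proof -
      have "\<bar>(\<integral>\<omega>. h (Y n \<omega>) \<partial>M) - (\<integral>\<omega>. h (ray (G\<^sub>0 \<omega>)) \<partial>N)\<bar>
          = \<bar>\<integral>\<omega>. h (ray (G n \<omega>)) - h (Y n \<omega>) \<partial>M\<bar>"
        using hY hG[OF n] transfer[OF n hray] by (simp add: abs_minus_commute)
      also have "\<dots> \<le> (\<integral>\<omega>. \<bar>h (ray (G n \<omega>)) - h (Y n \<omega>)\<bar> \<partial>M)"
        by (rule integral_abs_bound)
      also have "\<dots> \<le> (\<integral>\<omega>. e / 3 + 2 * B * (\<bar>G n \<omega>\<bar> / K + D n \<omega> * (2 / d)) \<partial>M)"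
        using hY hG[OF n] absG[OF n] D[OF n] pointwise[OF n] by (intro integral_mono) auto
      also have "\<dots> = e / 3 + 2 * B * (C / K + (\<integral>\<omega>. D n \<omega> \<partial>M) * (2 / d))"
        using absG[OF n] D[OF n] transfer[OF n, of "\<lambda>x. \<bar>x\<bar>"] by (simp add: C_def M.prob_space)
      finally show ?thesis .
    qed
    have "(\<lambda>n. 2 * B * ((\<integral>\<omega>. D n \<omega> \<partial>M) * (2 / d))) \<longlonglongrightarrow> 2 * B * (0 * (2 / d))"
      by (intro tendsto_intros lim)
    then have "\<forall>\<^sub>F n in sequentially. 2 * B * ((\<integral>\<omega>. D n \<omega> \<partial>M) * (2 / d)) < e / 3"
      using e by (intro order_tendstoD(2)) auto
    then have "\<forall>\<^sub>F n in sequentially. norm ((\<integral>\<omega>. h (Y n \<omega>) \<partial>M) - (\<integral>\<omega>. h (ray (G\<^sub>0 \<omega>)) \<partial>N)) < e"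
      using eventually_ge_at_top[of 1]
    proof eventually_elim
      case (elim n)
      then show ?case
        using bound[OF elim(2)] K(2) unfolding real_norm_def distrib_left by linarith
    qed
    then show "\<exists>no. \<forall>n\<ge>no. norm ((\<integral>\<omega>. h (Y n \<omega>) \<partial>M) - (\<integral>\<omega>. h (ray (G\<^sub>0 \<omega>)) \<partial>N)) < e"
      by (simp add: eventually_sequentially)
  qed
qed

text \<open>Truncating the index at \<open>n\<close> changes nothing for \<open>t \<le> 1\<close> and restricts the measurability
  hypothesis to the entries that occur in the sums; for \<open>n = 0\<close> it is void.\<close>

lemma measurable_path_normalized_sum:
  assumes "\<And>k. k \<in> {1..n} \<Longrightarrow> (\<lambda>\<omega>. g (X n k \<omega>)) \<in> borel_measurable M"
  shows "path_of (normalized_sum M X g n) \<in> measurable M (borel_sets_of skorokhod_topology)"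
proof -
  define S where "S = (\<lambda>\<omega> j. \<Sum>k = 1..min j n. g (X n k \<omega>))"
  define v where "v = (\<lambda>\<omega> j. (S \<omega> j - prob_space.expectation M (\<lambda>\<omega>. S \<omega> j))
    / sqrt (prob_space.variance M (partial_sum X g n 1)))"
  have [measurable]: "(\<lambda>\<omega>. S \<omega> j) \<in> borel_measurable M" for j
    unfolding S_def by (intro borel_measurable_sum assms) auto
  have "(\<lambda>\<omega>. v \<omega> j) \<in> borel_measurable M" for j
    unfolding v_def by measurable
  then have "v \<in> borel_measurable M"
    by (rule measurable_coordinatewise_then_product)
  from measurable_compose[OF this measurable_step_path, of n]
  have "(\<lambda>\<omega>. step_path n (v \<omega>)) \<in> measurable M (borel_sets_of skorokhod_topology)" .
  also have "(\<lambda>\<omega>. step_path n (v \<omega>)) = path_of (normalized_sum M X g n)"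
    by (simp add: fun_eq_iff path_of_def step_path_def v_def normalized_sum_def
        partial_sum_def[abs_def] S_def min_absorb1 floor_index_le restrict_def)
  finally show ?thesis .
qed


section \<open>Sums of slowly varying Hermite combinations\<close>

definition hermite_comb :: "(nat \<Rightarrow> real) \<Rightarrow> nat set \<Rightarrow> real \<Rightarrow> real" where
  "hermite_comb r Q x = (\<Sum>q\<in>Q. r q * hermite q x)"

lemma borel_measurable_hermite_comb [measurable]: "hermite_comb r Q \<in> borel_measurable borel"
  unfolding hermite_comb_def[abs_def] by measurable

lemma hermite_comb_mult:
  "hermite_comb r Q x * hermite_comb r Q y = (\<Sum>q\<in>Q. \<Sum>s\<in>Q. (r q * r s) * (hermite q x * hermite s y))"
  unfolding hermite_comb_def sum_product by (intro sum.cong refl) simp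

text \<open>The normalisation is that of unit variance; as \<open>q! \<ge> 1\<close>, it bounds the plain sum of squares of
  the coefficients, and the Cauchy-Schwarz inequality applies.\<close>

lemma hermite_comb_diff_sq_le:
  assumes "(\<Sum>q\<in>Q. (r q)\<^sup>2 * fact q) = 1"
  shows "(hermite_comb r Q x - hermite_comb r Q y)\<^sup>2 \<le> (\<Sum>q\<in>Q. (hermite q x - hermite q y)\<^sup>2)"
proof -
  have "hermite_comb r Q x - hermite_comb r Q y = (\<Sum>q\<in>Q. r q * (hermite q x - hermite q y))"
    by (simp add: hermite_comb_def sum_subtractf right_diff_distrib)
  then have "(hermite_comb r Q x - hermite_comb r Q y)\<^sup>2
      \<le> (\<Sum>q\<in>Q. (r q)\<^sup>2) * (\<Sum>q\<in>Q. (hermite q x - hermite q y)\<^sup>2)"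
    using Cauchy_Schwarz_ineq_sum[of r "\<lambda>q. hermite q x - hermite q y" Q] by simp
  also have "(\<Sum>q\<in>Q. (r q)\<^sup>2) \<le> (\<Sum>q\<in>Q. (r q)\<^sup>2 * fact q)"
    by (intro sum_mono) (simp add: mult_left_le fact_ge_1 mult_le_cancel_left1)
  also have "\<dots> = 1"
    by (rule assms)
  finally show ?thesis
    by (simp add: mult_right_mono sum_nonneg)
qed

context prob_space
begin

lemma integrable_hermite_comb:
  assumes "distributed M lborel U std_normal_density"
  shows "integrable M (\<lambda>\<omega>. hermite_comb r Q (U \<omega>))"
  unfolding hermite_comb_def by (intro Bochner_Integration.integrable_sum integrable_mult_right integrable_hermite assms)

lemma expectation_hermite_comb:
  assumes "distributed M lborel U std_normal_density" "0 \<notin> Q"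
  shows "expectation (\<lambda>\<omega>. hermite_comb r Q (U \<omega>)) = 0"
proof -
  have "expectation (\<lambda>\<omega>. hermite q (U \<omega>)) = 0" if "q \<in> Q" for q
    using that assms(2) by (intro expectation_hermite[OF assms(1)]) (metis gr0I)
  then show ?thesis
    unfolding hermite_comb_def using integrable_hermite[OF assms(1)]
    by (subst Bochner_Integration.integral_sum) auto
qed

lemma integrable_hermite_comb_mult:
  assumes "distributed M lborel U std_normal_density" "distributed M lborel V std_normal_density"
  shows "integrable M (\<lambda>\<omega>. hermite_comb r Q (U \<omega>) * hermite_comb r Q (V \<omega>))"
  unfolding hermite_comb_mult
  by (intro Bochner_Integration.integrable_sum integrable_mult_right integrable_hermite_mult assms)

lemma expectation_hermite_comb_sq:
  assumes "distributed M lborel U std_normal_density" "finite Q"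
  shows "expectation (\<lambda>\<omega>. (hermite_comb r Q (U \<omega>))\<^sup>2) = (\<Sum>q\<in>Q. (r q)\<^sup>2 * fact q)"
proof -
  have "expectation (\<lambda>\<omega>. (hermite_comb r Q (U \<omega>))\<^sup>2) =
      (\<Sum>q\<in>Q. \<Sum>s\<in>Q. (r q * r s) * (if q = s then fact q else 0))"
    unfolding power2_eq_square hermite_comb_mult using integrable_hermite_mult[OF assms(1) assms(1)]
    by (simp add: expectation_hermite_mult[OF assms(1)] Bochner_Integration.integral_sum)
  also have "\<dots> = (\<Sum>q\<in>Q. (r q)\<^sup>2 * fact q)"
    using assms(2) by (simp add: if_distrib sum.delta power2_eq_square cong: if_cong)
  finally show ?thesis .
qed

lemma expectation_hermite_comb_diff_sq:
  assumes U: "distributed M lborel U std_normal_density" and V: "distributed M lborel V std_normal_density"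
    and unit: "(\<Sum>q\<in>Q. (r q)\<^sup>2 * fact q) = 1"
    and diff: "\<And>q. q \<in> Q \<Longrightarrow> expectation (\<lambda>\<omega>. (hermite q (U \<omega>) - hermite q (V \<omega>))\<^sup>2) \<le> \<eta>"
  shows "integrable M (\<lambda>\<omega>. (hermite_comb r Q (U \<omega>) - hermite_comb r Q (V \<omega>))\<^sup>2)"
    and "expectation (\<lambda>\<omega>. (hermite_comb r Q (U \<omega>) - hermite_comb r Q (V \<omega>))\<^sup>2) \<le> real (card Q) * \<eta>"
proof -
  have int: "integrable M (\<lambda>\<omega>. (hermite q (U \<omega>) - hermite q (V \<omega>))\<^sup>2)" for q
    using integrable_hermite_mult[OF U U, of q q] integrable_hermite_mult[OF V V, of q q]
      integrable_hermite_mult[OF U V, of q q]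
    by (simp add: power2_diff) (simp add: power2_eq_square mult.assoc)
  show int_comb: "integrable M (\<lambda>\<omega>. (hermite_comb r Q (U \<omega>) - hermite_comb r Q (V \<omega>))\<^sup>2)"
    using integrable_hermite_comb_mult[OF U U, of r Q] integrable_hermite_comb_mult[OF V V, of r Q]
      integrable_hermite_comb_mult[OF U V, of r Q]
    by (simp add: power2_diff) (simp add: power2_eq_square mult.assoc)
  have "expectation (\<lambda>\<omega>. (hermite_comb r Q (U \<omega>) - hermite_comb r Q (V \<omega>))\<^sup>2)
      \<le> expectation (\<lambda>\<omega>. \<Sum>q\<in>Q. (hermite q (U \<omega>) - hermite q (V \<omega>))\<^sup>2)"
    by (intro integral_mono int_comb Bochner_Integration.integrable_sum int hermite_comb_diff_sq_le unit)
  also have "\<dots> = (\<Sum>q\<in>Q. expectation (\<lambda>\<omega>. (hermite q (U \<omega>) - hermite q (V \<omega>))\<^sup>2))"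
    by (intro Bochner_Integration.integral_sum int)
  also have "\<dots> \<le> real (card Q) * \<eta>"
    using sum_mono[of Q _ "\<lambda>_. \<eta>", OF diff] by simp
  finally show "expectation (\<lambda>\<omega>. (hermite_comb r Q (U \<omega>) - hermite_comb r Q (V \<omega>))\<^sup>2) \<le> real (card Q) * \<eta>" .
qed

lemma expectation_sq_le:
  fixes Y :: "'a \<Rightarrow> real"
  assumes "integrable M Y" "integrable M (\<lambda>\<omega>. (Y \<omega>)\<^sup>2)"
  shows "(expectation Y)\<^sup>2 \<le> expectation (\<lambda>\<omega>. (Y \<omega>)\<^sup>2)"
  using variance_eq[OF assms] variance_positive[of Y] by simp

text \<open>The total drift \<open>D\<close> away from time \<open>0\<close> dominates the error made when each summand of a partial
  sum is replaced by its initial value, for all partial sums simultaneously.\<close>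

lemma hermite_drift:
  fixes W :: "nat \<Rightarrow> 'a \<Rightarrow> real"
  assumes W: "\<And>k. distributed M lborel (W k) std_normal_density"
    and unit: "(\<Sum>q\<in>Q. (r q)\<^sup>2 * fact q) = 1"
    and diff: "\<And>q k. q \<in> Q \<Longrightarrow> k \<in> {1..n} \<Longrightarrow>
      expectation (\<lambda>\<omega>. (hermite q (W k \<omega>) - hermite q (W 0 \<omega>))\<^sup>2) \<le> \<eta>"
  defines "D \<equiv> \<lambda>\<omega>. \<Sum>k=1..n. \<bar>hermite_comb r Q (W k \<omega>) - hermite_comb r Q (W 0 \<omega>)\<bar>"
  shows "integrable M D" and "integrable M (\<lambda>\<omega>. (D \<omega>)\<^sup>2)"
    and "expectation (\<lambda>\<omega>. (D \<omega>)\<^sup>2) \<le> (real n)\<^sup>2 * (real (card Q) * \<eta>)"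
    and "expectation D \<le> real n * sqrt (real (card Q) * \<eta>)"
proof -
  let ?d = "\<lambda>k \<omega>. hermite_comb r Q (W k \<omega>) - hermite_comb r Q (W 0 \<omega>)"
  have d1: "integrable M (?d k)" for k
    by (intro Bochner_Integration.integrable_diff integrable_hermite_comb W)
  have d2: "integrable M (\<lambda>\<omega>. (?d k \<omega>)\<^sup>2)" "expectation (\<lambda>\<omega>. (?d k \<omega>)\<^sup>2) \<le> real (card Q) * \<eta>"
    if "k \<in> {1..n}" for k
    using expectation_hermite_comb_diff_sq[OF W W unit diff[OF _ that]] by blast+
  show int: "integrable M D"
    unfolding D_def by (intro Bochner_Integration.integrable_sum integrable_abs d1)
  have bound: "(D \<omega>)\<^sup>2 \<le> real n * (\<Sum>k=1..n. (?d k \<omega>)\<^sup>2)" for \<omega>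
    using Cauchy_Schwarz_ineq_sum[of "\<lambda>_. 1" "\<lambda>k. \<bar>?d k \<omega>\<bar>" "{1..n}"] by (simp add: D_def)
  have int_bound: "integrable M (\<lambda>\<omega>. real n * (\<Sum>k=1..n. (?d k \<omega>)\<^sup>2))"
    by (intro integrable_mult_right Bochner_Integration.integrable_sum d2)
  show int2: "integrable M (\<lambda>\<omega>. (D \<omega>)\<^sup>2)"
  proof (rule Bochner_Integration.integrable_bound[OF int_bound])
    show "(\<lambda>\<omega>. (D \<omega>)\<^sup>2) \<in> borel_measurable M"
      using int by measurable
    show "AE \<omega> in M. norm ((D \<omega>)\<^sup>2) \<le> norm (real n * (\<Sum>k=1..n. (?d k \<omega>)\<^sup>2))"
      using bound by (intro AE_I2) (simp add: sum_nonneg)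
  qed
  have "expectation (\<lambda>\<omega>. (D \<omega>)\<^sup>2) \<le> expectation (\<lambda>\<omega>. real n * (\<Sum>k=1..n. (?d k \<omega>)\<^sup>2))"
    by (intro integral_mono int2 int_bound bound)
  also have "\<dots> = real n * (\<Sum>k=1..n. expectation (\<lambda>\<omega>. (?d k \<omega>)\<^sup>2))"
    by (simp add: Bochner_Integration.integral_sum d2 del: atLeastAtMost_iff)
  also have "\<dots> \<le> real n * (\<Sum>k=1..n. real (card Q) * \<eta>)"
    by (intro mult_left_mono sum_mono d2) auto
  also have "\<dots> = (real n)\<^sup>2 * (real (card Q) * \<eta>)"
    by (simp add: power2_eq_square)
  finally show D2: "expectation (\<lambda>\<omega>. (D \<omega>)\<^sup>2) \<le> (real n)\<^sup>2 * (real (card Q) * \<eta>)" .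
  have "(expectation D)\<^sup>2 \<le> (real n)\<^sup>2 * (real (card Q) * \<eta>)"
    using expectation_sq_le[OF int int2] D2 by linarith
  then have "expectation D \<le> sqrt ((real n)\<^sup>2 * (real (card Q) * \<eta>))"
    by (rule real_le_rsqrt)
  then show "expectation D \<le> real n * sqrt (real (card Q) * \<eta>)"
    by (simp add: real_sqrt_mult)
qed

text \<open>The sum \<open>T\<close> differs from \<open>x = n F (W\<^sub>0)\<close>, whose second moment is \<open>n\<^sup>2\<close>, by at most \<open>D\<close>. The cross
  term in \<open>T\<^sup>2 - x\<^sup>2\<close> is split by the weighted inequality \<open>2 \<bar>x y\<bar> \<le> \<theta> x\<^sup>2 + y\<^sup>2 / \<theta>\<close>, and
  \<open>\<theta> = sqrt \<rho>\<close> balances the two parts.\<close>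

lemma hermite_sum_variance:
  fixes W :: "nat \<Rightarrow> 'a \<Rightarrow> real"
  assumes W: "\<And>k. distributed M lborel (W k) std_normal_density"
    and Q: "finite Q" and unit: "(\<Sum>q\<in>Q. (r q)\<^sup>2 * fact q) = 1"
    and diff: "\<And>q k. q \<in> Q \<Longrightarrow> k \<in> {1..n} \<Longrightarrow>
      expectation (\<lambda>\<omega>. (hermite q (W k \<omega>) - hermite q (W 0 \<omega>))\<^sup>2) \<le> \<eta>"
    and \<eta>: "0 < \<eta>"
  defines "\<rho> \<equiv> real (card Q) * \<eta>"
  shows "\<bar>expectation (\<lambda>\<omega>. (\<Sum>k=1..n. hermite_comb r Q (W k \<omega>))\<^sup>2) - (real n)\<^sup>2\<bar>
    \<le> (real n)\<^sup>2 * (2 * sqrt \<rho> + \<rho>)"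
proof -
  let ?F = "\<lambda>k \<omega>. hermite_comb r Q (W k \<omega>)"
  define D where "D = (\<lambda>\<omega>. \<Sum>k=1..n. \<bar>?F k \<omega> - ?F 0 \<omega>\<bar>)"
  define T where "T = (\<lambda>\<omega>. \<Sum>k=1..n. ?F k \<omega>)"
  have drift: "integrable M (\<lambda>\<omega>. (D \<omega>)\<^sup>2)" "expectation (\<lambda>\<omega>. (D \<omega>)\<^sup>2) \<le> (real n)\<^sup>2 * \<rho>"
    unfolding D_def \<rho>_def by (rule hermite_drift[where W = W and r = r and Q = Q and n = n and \<eta> = \<eta>, OF W unit diff]; assumption)+
  have "Q \<noteq> {}"
    using unit by auto
  then have \<rho>: "\<rho> > 0"
    using Q \<eta> by (simp add: \<rho>_def card_gt_0_iff)
  define \<theta> where "\<theta> = sqrt \<rho>"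
  have \<theta>: "\<theta> > 0" "\<rho> = \<theta>\<^sup>2"
    using \<rho> by (simp_all add: \<theta>_def)
  have T2: "integrable M (\<lambda>\<omega>. (T \<omega>)\<^sup>2)"
    unfolding T_def power2_eq_square sum_product
    by (intro Bochner_Integration.integrable_sum integrable_hermite_comb_mult W)
  have F2: "integrable M (\<lambda>\<omega>. (?F 0 \<omega>)\<^sup>2)"
    unfolding power2_eq_square by (intro integrable_hermite_comb_mult W)
  have EF2: "expectation (\<lambda>\<omega>. (?F 0 \<omega>)\<^sup>2) = 1"
    using expectation_hermite_comb_sq[OF W Q] unit by simp
  have pointwise: "\<bar>(T \<omega>)\<^sup>2 - (real n)\<^sup>2 * (?F 0 \<omega>)\<^sup>2\<bar>
      \<le> (real n)\<^sup>2 * \<theta> * (?F 0 \<omega>)\<^sup>2 + (1 / \<theta> + 1) * (D \<omega>)\<^sup>2" for \<omega>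
  proof -
    define x where "x = real n * ?F 0 \<omega>"
    define y where "y = T \<omega> - x"
    have "y = (\<Sum>k=1..n. ?F k \<omega> - ?F 0 \<omega>)"
      by (simp add: y_def x_def T_def sum_subtractf)
    then have "\<bar>y\<bar> \<le> D \<omega>"
      unfolding D_def by (simp only: sum_abs)
    then have yD: "y\<^sup>2 \<le> (D \<omega>)\<^sup>2"
      by (rule abs_le_square_iff[THEN iffD1, OF order_trans]) simp
    have amgm: "2 * \<bar>x * y\<bar> \<le> \<theta> * x\<^sup>2 + y\<^sup>2 / \<theta>"
    proof -
      have "0 \<le> (\<theta> * \<bar>x\<bar> - \<bar>y\<bar>)\<^sup>2 / \<theta>"
        using \<theta> by simp
      also have "\<dots> = \<theta> * x\<^sup>2 + y\<^sup>2 / \<theta> - 2 * \<bar>x * y\<bar>"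
        using \<theta>(1) by (simp add: power2_diff power_mult_distrib abs_mult field_simps power2_eq_square)
      finally show ?thesis by simp
    qed
    have "(T \<omega>)\<^sup>2 - x\<^sup>2 = 2 * (x * y) + y\<^sup>2"
      by (simp add: y_def power2_eq_square algebra_simps)
    then have "\<bar>(T \<omega>)\<^sup>2 - x\<^sup>2\<bar> \<le> 2 * \<bar>x * y\<bar> + y\<^sup>2"
      using zero_le_power2[of y] by linarith
    also have "\<dots> \<le> \<theta> * x\<^sup>2 + (1 / \<theta> + 1) * y\<^sup>2"
      using amgm by (simp add: algebra_simps)
    also have "\<dots> \<le> \<theta> * x\<^sup>2 + (1 / \<theta> + 1) * (D \<omega>)\<^sup>2"
      using yD \<theta>(1) by (intro add_left_mono mult_left_mono) auto
    finally show ?thesis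
      by (simp add: x_def power_mult_distrib mult_ac)
  qed
  have "\<bar>expectation (\<lambda>\<omega>. (T \<omega>)\<^sup>2) - (real n)\<^sup>2\<bar> = \<bar>expectation (\<lambda>\<omega>. (T \<omega>)\<^sup>2 - (real n)\<^sup>2 * (?F 0 \<omega>)\<^sup>2)\<bar>"
    using T2 F2 EF2 by simp
  also have "\<dots> \<le> expectation (\<lambda>\<omega>. \<bar>(T \<omega>)\<^sup>2 - (real n)\<^sup>2 * (?F 0 \<omega>)\<^sup>2\<bar>)"
    by (rule integral_abs_bound)
  also have "\<dots> \<le> expectation (\<lambda>\<omega>. (real n)\<^sup>2 * \<theta> * (?F 0 \<omega>)\<^sup>2 + (1 / \<theta> + 1) * (D \<omega>)\<^sup>2)"
    using T2 F2 drift(1) pointwise by (intro integral_mono) auto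
  also have "\<dots> = (real n)\<^sup>2 * \<theta> + (1 / \<theta> + 1) * expectation (\<lambda>\<omega>. (D \<omega>)\<^sup>2)"
    using F2 drift(1) EF2 by simp
  also have "\<dots> \<le> (real n)\<^sup>2 * \<theta> + (1 / \<theta> + 1) * ((real n)\<^sup>2 * \<rho>)"
    using drift(2) \<theta>(1) by (intro add_left_mono mult_left_mono) auto
  also have "\<dots> = (real n)\<^sup>2 * (2 * sqrt \<rho> + \<rho>)"
    unfolding \<theta>_def[symmetric] unfolding \<theta>(2) using \<theta>(1) by (simp add: field_simps power2_eq_square)
  finally show ?thesis
    unfolding T_def .
qed

end

text \<open>By orthogonality the square root is the \<open>L\<^sup>2\<close> norm of the Hermite combination with weights \<open>w\<close>
  under the standard normal law.\<close>

definition unit_coeffs :: "nat set \<Rightarrow> (nat \<Rightarrow> real) \<Rightarrow> nat \<Rightarrow> real" where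
  "unit_coeffs Q w q = w q / sqrt (\<Sum>j\<in>Q. (w j)\<^sup>2 * fact j)"

lemma sum_fact_sq_pos:
  fixes w :: "nat \<Rightarrow> real"
  assumes "finite Q" "q \<in> Q" "w q \<noteq> 0"
  shows "0 < (\<Sum>j\<in>Q. (w j)\<^sup>2 * fact j)"
  using assms by (intro sum_pos2[of Q q]) auto

lemma unit_coeffs_norm:
  assumes "finite Q" "q \<in> Q" "w q \<noteq> 0"
  shows "(\<Sum>j\<in>Q. (unit_coeffs Q w j)\<^sup>2 * fact j) = 1"
  using sum_fact_sq_pos[of Q q w, OF assms]
  by (simp add: unit_coeffs_def power_divide sum_divide_distrib[symmetric])

lemma unit_coeffs_scale:
  assumes "0 < K"
  shows "unit_coeffs Q (\<lambda>q. K * w q) q = unit_coeffs Q w q"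
proof -
  have "(\<Sum>j\<in>Q. (K * w j)\<^sup>2 * fact j) = K\<^sup>2 * (\<Sum>j\<in>Q. (w j)\<^sup>2 * fact j)"
    by (simp add: power_mult_distrib sum_distrib_left mult.assoc)
  then show ?thesis
    using assms by (simp add: unit_coeffs_def real_sqrt_mult)
qed

lemma tendsto_unit_coeffs:
  assumes "\<And>q. q \<in> Q \<Longrightarrow> (\<lambda>n. w n q) \<longlonglongrightarrow> w\<^sub>0 q"
    and "finite Q" "q\<^sub>0 \<in> Q" "w\<^sub>0 q\<^sub>0 \<noteq> 0" and "q \<in> Q"
  shows "(\<lambda>n. unit_coeffs Q (w n) q) \<longlonglongrightarrow> unit_coeffs Q w\<^sub>0 q"
  unfolding unit_coeffs_def
  using sum_fact_sq_pos[of Q q\<^sub>0 w\<^sub>0] assms by (intro tendsto_intros) auto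

lemma unit_coeffs_single:
  assumes "finite Q" "q\<^sub>0 \<in> Q" "a \<noteq> 0"
  shows "unit_coeffs Q (\<lambda>q. if q = q\<^sub>0 then a else 0) q = (if q = q\<^sub>0 then sgn a / sqrt (fact q\<^sub>0) else 0)"
proof -
  have "(\<Sum>j\<in>Q. (if j = q\<^sub>0 then a else 0)\<^sup>2 * fact j) = (\<Sum>j\<in>Q. if j = q\<^sub>0 then a\<^sup>2 * fact j else 0)"
    by (intro sum.cong) auto
  also have "\<dots> = a\<^sup>2 * fact q\<^sub>0"
    using assms by simp
  finally have "sqrt (\<Sum>j\<in>Q. (if j = q\<^sub>0 then a else 0)\<^sup>2 * fact j) = \<bar>a\<bar> * sqrt (fact q\<^sub>0)"
    by (simp add: real_sqrt_mult)
  then show ?thesis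
    using assms(3) by (simp add: unit_coeffs_def sgn_if)
qed

text \<open>
  With \<open>j = \<lfloor>n t\<rfloor>\<close> the normalised sum is \<open>b / n\<close> times \<open>j F (W\<^sub>0)\<close> plus a remainder below the total
  drift. Comparing coefficients with those of the limiting line leaves three small errors: \<open>b r\<^sub>q\<close>
  against its limit, \<open>j / n\<close> against \<open>t\<close>, and the drift. The bound is free of \<open>t\<close>.
\<close>

lemma (in prob_space) normalized_sum_hermite_approx:
  fixes X :: "nat \<Rightarrow> nat \<Rightarrow> 'a \<Rightarrow> real" and W :: "nat \<Rightarrow> 'a \<Rightarrow> real"
  assumes n: "1 \<le> n" and W: "\<And>k. distributed M lborel (W k) std_normal_density"
    and Q: "0 \<notin> Q" and A: "0 < A"
    and g: "\<And>k \<omega>. g (X n k \<omega>) = A * hermite_comb r Q (W k \<omega>)"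
    and t: "t \<in> {0..1}"
  defines "b \<equiv> real n / sqrt (expectation (\<lambda>\<omega>. (\<Sum>k=1..n. hermite_comb r Q (W k \<omega>))\<^sup>2))"
  shows "\<bar>normalized_sum M X g n t \<omega> - t * hermite_comb r\<^sub>0 Q (W 0 \<omega>)\<bar> \<le>
    (\<Sum>q\<in>Q. (\<bar>b * r q - r\<^sub>0 q\<bar> + \<bar>r\<^sub>0 q\<bar> / real n) * \<bar>hermite q (W 0 \<omega>)\<bar>)
    + b / real n * (\<Sum>k=1..n. \<bar>hermite_comb r Q (W k \<omega>) - hermite_comb r Q (W 0 \<omega>)\<bar>)"
proof -
  let ?F = "\<lambda>k \<omega>. hermite_comb r Q (W k \<omega>)"
  define s where "s = expectation (\<lambda>\<omega>. (\<Sum>k=1..n. ?F k \<omega>)\<^sup>2)"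
  have b: "b = real n / sqrt s" "0 \<le> b"
    by (simp_all add: b_def s_def)
  define j where "j = nat \<lfloor>real n * t\<rfloor>"
  define x where "x = real j / real n"
  have n0: "real n > 0"
    using n by simp
  have nt: "0 \<le> real n * t" "real n * t \<le> real n"
    using t by (simp_all add: mult_left_le)
  have j: "real j \<le> real n * t" "real n * t < real j + 1" "j \<le> n"
    using nt unfolding j_def by linarith+
  have x: "0 \<le> x" "x \<le> 1" "\<bar>x - t\<bar> \<le> 1 / real n"
  proof -
    show "0 \<le> x" "x \<le> 1"
      using j(3) n0 by (simp_all add: x_def)
    have "\<bar>x - t\<bar> = \<bar>real j - real n * t\<bar> / real n"
      using n0 by (simp add: x_def field_simps)
    also have "\<dots> \<le> 1 / real n"
      using j n0 by (intro divide_right_mono) auto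
    finally show "\<bar>x - t\<bar> \<le> 1 / real n" .
  qed
  have psum: "partial_sum X g n u = (\<lambda>\<omega>. A * (\<Sum>k=1..nat \<lfloor>real n * u\<rfloor>. ?F k \<omega>))" for u
    by (simp add: partial_sum_def[abs_def] g sum_distrib_left)
  have mean: "expectation (partial_sum X g n u) = 0" for u
    unfolding psum using integrable_hermite_comb[OF W]
    by (simp add: Bochner_Integration.integral_sum expectation_hermite_comb[OF W Q])
  have "(\<lambda>\<omega>. (partial_sum X g n 1 \<omega> - expectation (partial_sum X g n 1))\<^sup>2) =
      (\<lambda>\<omega>. A\<^sup>2 * (\<Sum>k=1..n. ?F k \<omega>)\<^sup>2)"
    unfolding mean by (simp add: psum power_mult_distrib)
  then have var: "variance (partial_sum X g n 1) = A\<^sup>2 * s"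
    by (simp add: s_def)
  have T: "normalized_sum M X g n t \<omega> = b * ((\<Sum>k=1..j. ?F k \<omega>) / real n)"
    unfolding normalized_sum_def var unfolding mean
    using A n0 by (simp add: psum real_sqrt_mult b j_def)
  define R where "R = (\<Sum>k=1..j. ?F k \<omega> - ?F 0 \<omega>)"
  have sum_eq: "(\<Sum>k=1..j. ?F k \<omega>) = real j * ?F 0 \<omega> + R"
    by (simp add: R_def sum_subtractf)
  have "\<bar>R\<bar> \<le> (\<Sum>k=1..j. \<bar>?F k \<omega> - ?F 0 \<omega>\<bar>)"
    unfolding R_def by (rule sum_abs)
  also have "\<dots> \<le> (\<Sum>k=1..n. \<bar>?F k \<omega> - ?F 0 \<omega>\<bar>)"
    using j by (intro sum_mono2) auto
  finally have R: "\<bar>R\<bar> \<le> (\<Sum>k=1..n. \<bar>?F k \<omega> - ?F 0 \<omega>\<bar>)" .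
  have "normalized_sum M X g n t \<omega> - t * hermite_comb r\<^sub>0 Q (W 0 \<omega>)
      = (\<Sum>q\<in>Q. (b * x * r q - t * r\<^sub>0 q) * hermite q (W 0 \<omega>)) + b / real n * R"
    unfolding T sum_eq
    by (simp add: hermite_comb_def x_def sum_distrib_left sum_subtractf algebra_simps add_divide_distrib
        sum_divide_distrib)
  also have "\<bar>\<dots>\<bar> \<le> \<bar>\<Sum>q\<in>Q. (b * x * r q - t * r\<^sub>0 q) * hermite q (W 0 \<omega>)\<bar> + \<bar>b / real n * R\<bar>"
    by (rule abs_triangle_ineq)
  also have "\<dots> \<le> (\<Sum>q\<in>Q. (\<bar>b * r q - r\<^sub>0 q\<bar> + \<bar>r\<^sub>0 q\<bar> / real n) * \<bar>hermite q (W 0 \<omega>)\<bar>)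
      + b / real n * (\<Sum>k=1..n. \<bar>?F k \<omega> - ?F 0 \<omega>\<bar>)"
  proof (rule add_mono)
    have coeff: "\<bar>b * x * r q - t * r\<^sub>0 q\<bar> \<le> \<bar>b * r q - r\<^sub>0 q\<bar> + \<bar>r\<^sub>0 q\<bar> / real n" for q
    proof -
      have "b * x * r q - t * r\<^sub>0 q = x * (b * r q - r\<^sub>0 q) + (x - t) * r\<^sub>0 q"
        by (simp add: algebra_simps)
      then have "\<bar>b * x * r q - t * r\<^sub>0 q\<bar> \<le> x * \<bar>b * r q - r\<^sub>0 q\<bar> + \<bar>x - t\<bar> * \<bar>r\<^sub>0 q\<bar>"
        using abs_triangle_ineq[of "x * (b * r q - r\<^sub>0 q)" "(x - t) * r\<^sub>0 q"] x(1) by (simp add: abs_mult)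
      also have "\<dots> \<le> 1 * \<bar>b * r q - r\<^sub>0 q\<bar> + 1 / real n * \<bar>r\<^sub>0 q\<bar>"
        using x by (intro add_mono mult_right_mono) auto
      finally show ?thesis by simp
    qed
    show "\<bar>\<Sum>q\<in>Q. (b * x * r q - t * r\<^sub>0 q) * hermite q (W 0 \<omega>)\<bar>
        \<le> (\<Sum>q\<in>Q. (\<bar>b * r q - r\<^sub>0 q\<bar> + \<bar>r\<^sub>0 q\<bar> / real n) * \<bar>hermite q (W 0 \<omega>)\<bar>)"
      by (rule order_trans[OF sum_abs]) (auto simp: abs_mult intro!: sum_mono mult_right_mono coeff)
    show "\<bar>b / real n * R\<bar> \<le> b / real n * (\<Sum>k=1..n. \<bar>?F k \<omega> - ?F 0 \<omega>\<bar>)"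
      using R b(2) n0 by (simp add: abs_mult divide_right_mono mult_left_mono)
  qed
  finally show ?thesis .
qed

text \<open>
  The only dependence that matters is that each row stays close to its initial entry, in the sense
  of \<open>diff\<close>. The bound of \<open>normalized_sum_hermite_approx\<close> has an expectation that tends to zero,
  because the law of \<open>W n 0\<close> is the same for all \<open>n\<close> and the mean drift per summand is at most
  \<open>sqrt (card Q * \<eta> n)\<close>.
\<close>

theorem hermite_array_limit:
  fixes M :: "'a measure" and N :: "'b measure" and X W :: "nat \<Rightarrow> nat \<Rightarrow> 'a \<Rightarrow> real"
    and r :: "nat \<Rightarrow> nat \<Rightarrow> real" and \<eta> A :: "nat \<Rightarrow> real"
  assumes M: "prob_space M" and N: "prob_space N"
    and Q: "finite Q" "0 \<notin> Q"
    and W: "\<And>n k. 1 \<le> n \<Longrightarrow> distributed M lborel (W n k) std_normal_density"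
    and g: "\<And>n k \<omega>. 1 \<le> n \<Longrightarrow> g n (X n k \<omega>) = A n * hermite_comb (r n) Q (W n k \<omega>)"
    and A: "\<And>n. 1 \<le> n \<Longrightarrow> 0 < A n"
    and unit: "\<And>n. 1 \<le> n \<Longrightarrow> (\<Sum>q\<in>Q. (r n q)\<^sup>2 * fact q) = 1"
    and r: "\<And>q. q \<in> Q \<Longrightarrow> (\<lambda>n. r n q) \<longlonglongrightarrow> r\<^sub>0 q"
    and diff: "\<And>n k q. 1 \<le> n \<Longrightarrow> k \<in> {1..n} \<Longrightarrow> q \<in> Q \<Longrightarrow>
      prob_space.expectation M (\<lambda>\<omega>. (hermite q (W n k \<omega>) - hermite q (W n 0 \<omega>))\<^sup>2) \<le> \<eta> n"
    and \<eta>: "\<And>n. 1 \<le> n \<Longrightarrow> 0 < \<eta> n" "\<eta> \<longlonglongrightarrow> 0"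
    and Z: "distributed N lborel Z std_normal_density"
  shows "converges_in_distribution skorokhod_topology M (\<lambda>n. path_of (normalized_sum M X (g n) n))
    N (\<lambda>\<omega>. ray (hermite_comb r\<^sub>0 Q (Z \<omega>)))"
proof -
  interpret M: prob_space M by (rule M)
  interpret N: prob_space N by (rule N)
  let ?F = "\<lambda>n k \<omega>. hermite_comb (r n) Q (W n k \<omega>)"
  define s where "s n = M.expectation (\<lambda>\<omega>. (\<Sum>k=1..n. ?F n k \<omega>)\<^sup>2)" for n
  define b where "b n = real n / sqrt (s n)" for n
  define \<rho> where "\<rho> n = real (card Q) * \<eta> n" for n
  define D where "D n \<omega> = (\<Sum>q\<in>Q. (\<bar>b n * r n q - r\<^sub>0 q\<bar> + \<bar>r\<^sub>0 q\<bar> / real n) * \<bar>hermite q (W n 0 \<omega>)\<bar>)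
    + b n / real n * (\<Sum>k=1..n. \<bar>?F n k \<omega> - ?F n 0 \<omega>\<bar>)" for n \<omega>
  have \<rho>: "\<rho> \<longlonglongrightarrow> 0"
    unfolding \<rho>_def[abs_def] using tendsto_mult_right_zero[OF \<eta>(2)] .
  \<comment> \<open>\<open>s n\<close> is asymptotic to \<open>n\<^sup>2\<close>, the second moment of \<open>n\<close> identical unit-variance summands.\<close>
  have b_lim: "b \<longlonglongrightarrow> 1"
  proof -
    have "(\<lambda>n. 2 * sqrt (\<rho> n) + \<rho> n) \<longlonglongrightarrow> 2 * sqrt 0 + 0"
      by (intro tendsto_intros \<rho>)
    then have "(\<lambda>n. 2 * sqrt (\<rho> n) + \<rho> n) \<longlonglongrightarrow> 0"
      by simp
    moreover have "\<forall>\<^sub>F n in sequentially. norm (s n / (real n)\<^sup>2 - 1) \<le> 2 * sqrt (\<rho> n) + \<rho> n"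
      using eventually_ge_at_top[of 1]
    proof eventually_elim
      case (elim n)
      have "\<bar>s n - (real n)\<^sup>2\<bar> \<le> (real n)\<^sup>2 * (2 * sqrt (\<rho> n) + \<rho> n)"
        unfolding s_def \<rho>_def
        by (rule M.hermite_sum_variance[where W = "W n" and r = "r n" and Q = Q and n = n and \<eta> = "\<eta> n", OF W[OF elim] Q(1) unit[OF elim] diff[OF elim] \<eta>(1)[OF elim]])
      then have "\<bar>s n - (real n)\<^sup>2\<bar> / (real n)\<^sup>2 \<le> 2 * sqrt (\<rho> n) + \<rho> n"
        using elim by (simp add: pos_divide_le_eq mult.commute)
      moreover have "s n / (real n)\<^sup>2 - 1 = (s n - (real n)\<^sup>2) / (real n)\<^sup>2"
        using elim by (simp add: field_simps)
      ultimately show ?case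
        by simp
    qed
    ultimately have "(\<lambda>n. s n / (real n)\<^sup>2 - 1) \<longlonglongrightarrow> 0"
      by (rule Lim_null_comparison[rotated])
    then have "(\<lambda>n. 1 / sqrt (s n / (real n)\<^sup>2)) \<longlonglongrightarrow> 1 / sqrt 1"
      by (intro tendsto_intros) (simp_all add: LIM_zero_iff)
    moreover have "(\<lambda>n. 1 / sqrt (s n / (real n)\<^sup>2)) = b"
      by (simp add: b_def fun_eq_iff real_sqrt_divide)
    ultimately show ?thesis
      by simp
  qed
  have b0: "0 \<le> b n" for n
    by (simp add: b_def s_def)
  have abs_hermite: "integrable M (\<lambda>\<omega>. \<bar>hermite q (W n 0 \<omega>)\<bar>)" if "1 \<le> n" for n q
    by (intro integrable_abs M.integrable_hermite W that)
  have drift: "integrable M (\<lambda>\<omega>. \<Sum>k=1..n. \<bar>?F n k \<omega> - ?F n 0 \<omega>\<bar>)"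
    "M.expectation (\<lambda>\<omega>. \<Sum>k=1..n. \<bar>?F n k \<omega> - ?F n 0 \<omega>\<bar>) \<le> real n * sqrt (\<rho> n)" if n: "1 \<le> n" for n
    unfolding \<rho>_def by (rule M.hermite_drift[where W = "W n" and r = "r n" and Q = Q and n = n and \<eta> = "\<eta> n", OF W[OF n] unit[OF n] diff[OF n]]; assumption)+
  define C where "C q = (\<integral>x. \<bar>hermite q x\<bar> \<partial>std_normal)" for q
  have D_int: "integrable M (D n)" if n: "1 \<le> n" for n
    unfolding D_def by (intro Bochner_Integration.integrable_add Bochner_Integration.integrable_sum
        integrable_mult_right abs_hermite drift n)
  have D_nonneg: "0 \<le> D n \<omega>" for n \<omega>
    unfolding D_def by (intro add_nonneg_nonneg sum_nonneg mult_nonneg_nonneg divide_nonneg_nonneg b0) auto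
  have D_le: "M.expectation (D n) \<le> (\<Sum>q\<in>Q. (\<bar>b n * r n q - r\<^sub>0 q\<bar> + \<bar>r\<^sub>0 q\<bar> / real n) * C q) + b n * sqrt (\<rho> n)"
    if n: "1 \<le> n" for n
  proof -
    have C: "M.expectation (\<lambda>\<omega>. \<bar>hermite q (W n 0 \<omega>)\<bar>) = C q" for q
      unfolding C_def by (rule M.expectation_std_normal[OF W[OF n]]) measurable
    have "M.expectation (D n) = (\<Sum>q\<in>Q. (\<bar>b n * r n q - r\<^sub>0 q\<bar> + \<bar>r\<^sub>0 q\<bar> / real n) * C q)
        + b n / real n * M.expectation (\<lambda>\<omega>. \<Sum>k=1..n. \<bar>?F n k \<omega> - ?F n 0 \<omega>\<bar>)"
      unfolding D_def using abs_hermite[OF n] drift(1)[OF n]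
      by (simp add: Bochner_Integration.integral_sum C del: One_nat_def)
    also have "b n / real n * M.expectation (\<lambda>\<omega>. \<Sum>k=1..n. \<bar>?F n k \<omega> - ?F n 0 \<omega>\<bar>)
        \<le> b n / real n * (real n * sqrt (\<rho> n))"
      by (intro mult_left_mono drift n divide_nonneg_nonneg b0) simp
    also have "\<dots> = b n * sqrt (\<rho> n)"
      using n by simp
    finally show ?thesis by simp
  qed
  have "(\<lambda>n. (\<Sum>q\<in>Q. (\<bar>b n * r n q - r\<^sub>0 q\<bar> + \<bar>r\<^sub>0 q\<bar> / real n) * C q) + b n * sqrt (\<rho> n))
      \<longlonglongrightarrow> (\<Sum>q\<in>Q. (\<bar>1 * r\<^sub>0 q - r\<^sub>0 q\<bar> + 0) * C q) + 1 * sqrt 0"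
    by (intro tendsto_intros b_lim r \<rho> lim_const_over_n)
  then have "(\<lambda>n. (\<Sum>q\<in>Q. (\<bar>b n * r n q - r\<^sub>0 q\<bar> + \<bar>r\<^sub>0 q\<bar> / real n) * C q) + b n * sqrt (\<rho> n)) \<longlonglongrightarrow> 0"
    by simp
  moreover have "\<forall>\<^sub>F n in sequentially. norm (M.expectation (D n)) \<le>
      (\<Sum>q\<in>Q. (\<bar>b n * r n q - r\<^sub>0 q\<bar> + \<bar>r\<^sub>0 q\<bar> / real n) * C q) + b n * sqrt (\<rho> n)"
    using eventually_ge_at_top[of 1]
    by eventually_elim (simp add: D_le D_nonneg integral_nonneg)
  ultimately have D_lim: "(\<lambda>n. M.expectation (D n)) \<longlonglongrightarrow> 0"
    by (rule Lim_null_comparison[rotated])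
  show ?thesis
  proof (rule converges_in_distribution_ray[OF M N _ _ _ _ D_int _ D_lim])
    show "path_of (normalized_sum M X (g n) n) \<in> measurable M (borel_sets_of skorokhod_topology)" for n
    proof (rule measurable_path_normalized_sum)
      fix k assume "k \<in> {1..n}"
      then have n: "1 \<le> n" by simp
      have [measurable]: "W n k \<in> borel_measurable M"
        by (rule M.std_normal_measurable[OF W[OF n]])
      show "(\<lambda>\<omega>. g n (X n k \<omega>)) \<in> borel_measurable M"
        by (simp add: g[OF n])
    qed
    show "integrable N (\<lambda>\<omega>. hermite_comb r\<^sub>0 Q (Z \<omega>))"
      by (rule N.integrable_hermite_comb[OF Z])
    fix n :: nat assume n: "1 \<le> n"
    have meas: "W n 0 \<in> borel_measurable M" "Z \<in> borel_measurable N"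
      by (rule M.std_normal_measurable[OF W[OF n]] N.std_normal_measurable[OF Z])+
    show "(\<lambda>\<omega>. hermite_comb r\<^sub>0 Q (W n 0 \<omega>)) \<in> borel_measurable M"
      using meas by measurable
    show "distr M borel (\<lambda>\<omega>. hermite_comb r\<^sub>0 Q (W n 0 \<omega>)) = distr N borel (\<lambda>\<omega>. hermite_comb r\<^sub>0 Q (Z \<omega>))"
      using distr_distr[of "hermite_comb r\<^sub>0 Q" borel borel "W n 0" M] distr_distr[of "hermite_comb r\<^sub>0 Q" borel borel Z N] meas
      by (simp add: comp_def M.distr_std_normal[OF W[OF n]] N.distr_std_normal[OF Z])
    fix \<omega> t assume t: "t \<in> {0..1::real}"
    show "\<bar>path_of (normalized_sum M X (g n) n) \<omega> t - t * hermite_comb r\<^sub>0 Q (W n 0 \<omega>)\<bar> \<le> D n \<omega>"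
      unfolding D_def b_def s_def
      using M.normalized_sum_hermite_approx[where W = "W n" and X = X and n = n and Q = Q and r = "r n"
          and A = "A n" and g = "g n" and r\<^sub>0 = r\<^sub>0 and \<omega> = \<omega>, OF n W[OF n] Q(2) A[OF n] g[OF n] t] t
      by (simp add: path_of_def)
  qed
qed

text \<open>Bernoulli's inequality gives \<open>1 - a\<^sup>k\<^sup>q \<le> k q (1 - a)\<close>; the absolute value makes the bound
  monotone in \<open>k q\<close>, hence uniform over the row and over the degrees.\<close>

lemma hermite_diff_sq_le:
  fixes a :: real
  assumes "0 \<le> a" "k \<le> n" "q \<le> p"
  shows "2 * fact q * (1 - a ^ (k * q)) \<le> 2 * fact p * (real n * real p * \<bar>1 - a\<bar>)"
proof -
  have "1 + real (k * q) * (a - 1) \<le> (1 + (a - 1)) ^ (k * q)"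
    by (rule Bernoulli_inequality) (use assms in simp)
  then have "1 - a ^ (k * q) \<le> real (k * q) * (1 - a)"
    by (simp add: algebra_simps)
  also have "\<dots> \<le> real (k * q) * \<bar>1 - a\<bar>"
    by (intro mult_left_mono) auto
  also have "\<dots> \<le> real n * real p * \<bar>1 - a\<bar>"
    using assms by (intro mult_right_mono) (auto simp flip: of_nat_mult intro: mult_mono)
  finally have *: "1 - a ^ (k * q) \<le> real n * real p * \<bar>1 - a\<bar>" .
  have "2 * fact q * (1 - a ^ (k * q)) \<le> 2 * fact q * (real n * real p * \<bar>1 - a\<bar>)"
    using * by (intro mult_left_mono) auto
  also have "\<dots> \<le> 2 * fact p * (real n * real p * \<bar>1 - a\<bar>)"
    using assms by (intro mult_right_mono mult_left_mono fact_mono) auto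
  finally show ?thesis .
qed

lemma path_of_ray:
  assumes "\<And>\<omega>. G \<omega> = g \<omega>"
  shows "path_of (\<lambda>t \<omega>. t * G \<omega>) = (\<lambda>\<omega>. ray (g \<omega>))"
  by (simp add: path_of_def[abs_def] ray_def[abs_def] assms)


section \<open>The limit theorem\<close>

theorem theorem5p3:
  fixes M :: "'a measure" and N :: "'b measure"
    and \<gamma> \<beta> :: real and \<alpha> \<sigma> \<delta> :: "nat \<Rightarrow> real"
    and \<epsilon> :: "nat \<Rightarrow> 'a \<Rightarrow> real" and X :: "nat \<Rightarrow> nat \<Rightarrow> 'a \<Rightarrow> real"
    and m p :: nat and c :: "nat \<Rightarrow> real" and f :: "nat \<Rightarrow> real \<Rightarrow> real"
    and Z :: "'b \<Rightarrow> real"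
  assumes "prob_space M"
    and "0 < \<gamma>" and "\<gamma> < 1" and "1 < \<beta>"
    and \<alpha>: "\<And>n. 1 \<le> n \<Longrightarrow> \<alpha> n = 1 - \<gamma> / real n powr \<beta>"
    and \<sigma>: "\<And>n. 1 \<le> n \<Longrightarrow> 0 < \<sigma> n"
    and \<delta>: "\<And>n. 1 \<le> n \<Longrightarrow> \<delta> n = sqrt ((\<sigma> n)\<^sup>2 / (1 - (\<alpha> n)\<^sup>2))"
    and innovations: "\<And>j. 1 \<le> j \<Longrightarrow> distributed M lborel (\<epsilon> j) std_normal_density"
    and initial: "\<And>n. 1 \<le> n \<Longrightarrow> distributed M lborel (X n 0) (normal_density 0 (\<delta> n))"
    and indep: "\<And>n. 1 \<le> n \<Longrightarrow>
      prob_space.indep_vars M (\<lambda>_. borel) (\<lambda>j. if j = 0 then X n 0 else \<epsilon> j) UNIV"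
    and recursion: "\<And>n j \<omega>. 1 \<le> n \<Longrightarrow> 1 \<le> j \<Longrightarrow> \<omega> \<in> space M \<Longrightarrow>
      X n j \<omega> = \<alpha> n * X n (j - 1) \<omega> + \<sigma> n * \<epsilon> j \<omega>"
    and "1 \<le> m" and "m \<le> p" and "c m \<noteq> 0" and "c p \<noteq> 0"
    and f: "\<And>n x. 1 \<le> n \<Longrightarrow> f n x = (\<Sum>q = m..p. c q * \<delta> n ^ q * hermite q (x / \<delta> n))"
    and "prob_space N" and Z: "distributed N lborel Z std_normal_density"
  shows "((\<lambda>n. 1 - (\<alpha> n)\<^sup>2) \<in> o(\<lambda>n. (\<sigma> n)\<^sup>2) \<longrightarrow>
           converges_in_distribution skorokhod_topology
             M (\<lambda>n. path_of (normalized_sum M X (f n) n))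
             N (path_of (\<lambda>t \<omega>. t * (sgn (c p) * hermite p (Z \<omega>) / sqrt (fact p))))) \<and>
         ((\<lambda>n. (\<sigma> n)\<^sup>2) \<in> o(\<lambda>n. 1 - (\<alpha> n)\<^sup>2) \<longrightarrow>
           converges_in_distribution skorokhod_topology
             M (\<lambda>n. path_of (normalized_sum M X (f n) n))
             N (path_of (\<lambda>t \<omega>. t * (sgn (c m) * hermite m (Z \<omega>) / sqrt (fact m)))))"
proof -
  interpret M: prob_space M by fact
  interpret N: prob_space N by fact
  let ?Q = "{m..p}"
  have Q: "finite ?Q" "0 \<notin> ?Q" "m \<in> ?Q" "p \<in> ?Q"
    using \<open>1 \<le> m\<close> \<open>m \<le> p\<close> by auto
  have gap: "0 < \<gamma> / real n powr \<beta>" "\<gamma> / real n powr \<beta> < 1" if "1 \<le> n" for n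
  proof -
    have "1 \<le> real n powr \<beta>"
      using that \<open>1 < \<beta>\<close> by (intro ge_one_powr_ge_zero) auto
    then have "0 < real n powr \<beta>" "\<gamma> < real n powr \<beta>"
      using \<open>\<gamma> < 1\<close> by linarith+
    then show "0 < \<gamma> / real n powr \<beta>" "\<gamma> / real n powr \<beta> < 1"
      using \<open>0 < \<gamma>\<close> by (simp_all add: pos_divide_less_eq)
  qed
  have a: "0 < \<alpha> n" "\<alpha> n < 1" if "1 \<le> n" for n
    using gap[OF that] \<alpha>[OF that] by simp_all
  have a2: "0 < 1 - (\<alpha> n)\<^sup>2" if "1 \<le> n" for n
    using a[OF that] by (simp add: abs_square_less_1)
  have d: "0 < \<delta> n" "(\<delta> n)\<^sup>2 = (\<sigma> n)\<^sup>2 / (1 - (\<alpha> n)\<^sup>2)" if "1 \<le> n" for n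
    using a2[OF that] \<sigma>[OF that] \<delta>[OF that] by simp_all
  define W where "W n k \<omega> = X n k \<omega> / \<delta> n" for n k \<omega>
  have ar: "distributed M lborel (W n k) std_normal_density"
    "M.expectation (\<lambda>\<omega>. (hermite q (W n k \<omega>) - hermite q (W n 0 \<omega>))\<^sup>2) = 2 * fact q * (1 - \<alpha> n ^ (k * q))"
    if n: "1 \<le> n" for n k q
    unfolding W_def
    by (rule M.stationary_ar_hermite[where X = "X n" and \<epsilon> = \<epsilon>,
        OF a[OF n] \<sigma>[OF n] \<delta>[OF n] innovations initial[OF n] indep[OF n] recursion[OF n]]; assumption)+
  define w where "w n q = c q * \<delta> n ^ q" for n q
  define r where "r n = unit_coeffs ?Q (w n)" for n
  define A where "A n = sqrt (\<Sum>q\<in>?Q. (w n q)\<^sup>2 * fact q)" for n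
  have wp: "w n p \<noteq> 0" if "1 \<le> n" for n
    using d[OF that] \<open>c p \<noteq> 0\<close> by (simp add: w_def)
  have A: "0 < A n" if "1 \<le> n" for n
    unfolding A_def using sum_fact_sq_pos[of ?Q p "w n"] Q wp[OF that] by simp
  have unit: "(\<Sum>q\<in>?Q. (r n q)\<^sup>2 * fact q) = 1" if "1 \<le> n" for n
    unfolding r_def using Q wp[OF that] by (intro unit_coeffs_norm[of _ p]) auto
  have w_r: "w n q = A n * r n q" if "1 \<le> n" for n q
    using A[OF that] unfolding r_def unit_coeffs_def A_def[symmetric] by simp
  have f_comb: "f n (X n k \<omega>) = A n * hermite_comb (r n) ?Q (W n k \<omega>)" if "1 \<le> n" for n k \<omega>
  proof -
    have "f n (X n k \<omega>) = (\<Sum>q\<in>?Q. w n q * hermite q (W n k \<omega>))"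
      by (simp add: f[OF that] w_def W_def)
    then show ?thesis
      by (simp add: w_r[OF that] hermite_comb_def sum_distrib_left mult.assoc)
  qed
  define \<eta> where "\<eta> n = 2 * fact p * (real n * real p * \<bar>1 - \<alpha> n\<bar>)" for n
  have \<eta>_pos: "0 < \<eta> n" if "1 \<le> n" for n
    using a[OF that] that Q by (simp add: \<eta>_def)
  have \<eta>_lim: "\<eta> \<longlonglongrightarrow> 0"
  proof -
    have "(\<lambda>n. real n powr (1 - \<beta>)) \<longlonglongrightarrow> 0"
      using \<open>1 < \<beta>\<close> by (intro tendsto_neg_powr filterlim_real_sequentially) simp
    then have "(\<lambda>n. 2 * fact p * (real p * (\<gamma> * real n powr (1 - \<beta>)))) \<longlonglongrightarrow> 2 * fact p * (real p * (\<gamma> * 0))"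
      by (intro tendsto_intros)
    then have "(\<lambda>n. 2 * fact p * (real p * (\<gamma> * real n powr (1 - \<beta>)))) \<longlonglongrightarrow> 0"
      by simp
    then show ?thesis
    proof (rule Lim_transform_eventually)
      show "\<forall>\<^sub>F n in sequentially. 2 * fact p * (real p * (\<gamma> * real n powr (1 - \<beta>))) = \<eta> n"
        using eventually_ge_at_top[of 1]
      proof eventually_elim
        case (elim n)
        have "\<bar>1 - \<alpha> n\<bar> = \<gamma> / real n powr \<beta>"
          using \<open>0 < \<gamma>\<close> \<alpha>[OF elim] by simp
        then show ?case
          using elim by (simp add: \<eta>_def powr_diff)
      qed
    qed
  qed
  have diff: "M.expectation (\<lambda>\<omega>. (hermite q (W n k \<omega>) - hermite q (W n 0 \<omega>))\<^sup>2) \<le> \<eta> n"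
    if n: "1 \<le> n" and "k \<in> {1..n}" "q \<in> ?Q" for n k q
    unfolding ar(2)[OF n] \<eta>_def using that a[OF n] by (intro hermite_diff_sq_le) auto
  \<comment> \<open>Both regimes at once: after a common factor \<open>K\<close> is removed, the weight of degree \<open>q\<close> is
    \<open>c q\<close> times a power of a null sequence \<open>u\<close>, and only the degree \<open>q\<^sub>0\<close> has exponent zero. The
    choices are \<open>u = 1 / \<delta>\<close>, \<open>q\<^sub>0 = p\<close> when \<open>\<delta>\<close> diverges and \<open>u = \<delta>\<close>, \<open>q\<^sub>0 = m\<close> when it vanishes.\<close>
  have limit: "converges_in_distribution skorokhod_topology M (\<lambda>n. path_of (normalized_sum M X (f n) n))
      N (path_of (\<lambda>t \<omega>. t * (sgn (c q\<^sub>0) * hermite q\<^sub>0 (Z \<omega>) / sqrt (fact q\<^sub>0))))"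
    if q\<^sub>0: "q\<^sub>0 \<in> ?Q" "c q\<^sub>0 \<noteq> 0" and K: "\<And>n. 1 \<le> n \<Longrightarrow> 0 < K n"
      and w_eq: "\<And>n q. 1 \<le> n \<Longrightarrow> q \<in> ?Q \<Longrightarrow> w n q = K n * (c q * u n ^ e q)"
      and u: "u \<longlonglongrightarrow> 0" and e: "\<And>q. q \<in> ?Q \<Longrightarrow> e q = 0 \<longleftrightarrow> q = q\<^sub>0" for q\<^sub>0 e K u
  proof -
    let ?r\<^sub>0 = "\<lambda>q. if q = q\<^sub>0 then sgn (c q\<^sub>0) / sqrt (fact q\<^sub>0) else 0"
    have lim: "(\<lambda>n. r n q) \<longlonglongrightarrow> ?r\<^sub>0 q" if q: "q \<in> ?Q" for q
    proof -
      have "(\<lambda>n. c j * u n ^ e j) \<longlonglongrightarrow> (if j = q\<^sub>0 then c q\<^sub>0 else 0)" if j: "j \<in> ?Q" for j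
      proof -
        have "(\<lambda>n. c j * u n ^ e j) \<longlonglongrightarrow> c j * 0 ^ e j"
          by (intro tendsto_intros u)
        then show ?thesis
          using e[OF j] by (auto simp: power_0_left)
      qed
      then have "(\<lambda>n. unit_coeffs ?Q (\<lambda>j. c j * u n ^ e j) q)
          \<longlonglongrightarrow> unit_coeffs ?Q (\<lambda>j. if j = q\<^sub>0 then c q\<^sub>0 else 0) q"
        by (rule tendsto_unit_coeffs) (use q q\<^sub>0 Q in auto)
      also have "unit_coeffs ?Q (\<lambda>j. if j = q\<^sub>0 then c q\<^sub>0 else 0) q = ?r\<^sub>0 q"
        by (rule unit_coeffs_single) (use q\<^sub>0 Q in auto)
      finally show ?thesis
      proof (rule Lim_transform_eventually)
        show "\<forall>\<^sub>F n in sequentially. unit_coeffs ?Q (\<lambda>j. c j * u n ^ e j) q = r n q"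
          using eventually_ge_at_top[of 1]
        proof eventually_elim
          case (elim n)
          have "r n q = unit_coeffs ?Q (\<lambda>j. K n * (c j * u n ^ e j)) q"
            unfolding r_def unit_coeffs_def using w_eq[OF elim] q by simp
          then show ?case
            using unit_coeffs_scale[OF K[OF elim], of ?Q "\<lambda>j. c j * u n ^ e j" q] by simp
        qed
      qed
    qed
    have "sgn (c q\<^sub>0) * hermite q\<^sub>0 (Z \<omega>) / sqrt (fact q\<^sub>0) = hermite_comb ?r\<^sub>0 ?Q (Z \<omega>)" for \<omega>
      using q\<^sub>0 by (simp add: hermite_comb_def if_distrib[of "\<lambda>x. x * _"] cong: if_cong)
    then have path: "path_of (\<lambda>t \<omega>. t * (sgn (c q\<^sub>0) * hermite q\<^sub>0 (Z \<omega>) / sqrt (fact q\<^sub>0)))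
        = (\<lambda>\<omega>. ray (hermite_comb ?r\<^sub>0 ?Q (Z \<omega>)))"
      by (rule path_of_ray)
    show ?thesis
      unfolding path
      by (rule hermite_array_limit[where W = W and X = X and g = f and A = A and r = r and r\<^sub>0 = ?r\<^sub>0 and \<eta> = \<eta>,
          OF \<open>prob_space M\<close> \<open>prob_space N\<close> Q(1,2) ar(1) f_comb A unit lim diff \<eta>_pos \<eta>_lim Z])
  qed
  show ?thesis
  proof (intro conjI impI)
    assume "(\<lambda>n. 1 - (\<alpha> n)\<^sup>2) \<in> o(\<lambda>n. (\<sigma> n)\<^sup>2)"
    then have "(\<lambda>n. sqrt ((1 - (\<alpha> n)\<^sup>2) / (\<sigma> n)\<^sup>2)) \<longlonglongrightarrow> sqrt 0"
      by (intro tendsto_intros smalloD_tendsto)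
    moreover have "\<forall>\<^sub>F n in sequentially. sqrt ((1 - (\<alpha> n)\<^sup>2) / (\<sigma> n)\<^sup>2) = 1 / \<delta> n"
      using eventually_ge_at_top[of 1] by eventually_elim (simp add: \<delta> real_sqrt_divide)
    ultimately have "(\<lambda>n. 1 / \<delta> n) \<longlonglongrightarrow> sqrt 0"
      by (rule Lim_transform_eventually)
    then have "(\<lambda>n. 1 / \<delta> n) \<longlonglongrightarrow> 0"
      by simp
    then show "converges_in_distribution skorokhod_topology M (\<lambda>n. path_of (normalized_sum M X (f n) n))
      N (path_of (\<lambda>t \<omega>. t * (sgn (c p) * hermite p (Z \<omega>) / sqrt (fact p))))"
    proof (rule limit[of p "\<lambda>n. \<delta> n ^ p" "\<lambda>n. 1 / \<delta> n" "\<lambda>q. p - q", rotated 4])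
      fix n q :: nat assume n: "1 \<le> n" and q: "q \<in> ?Q"
      have "\<delta> n ^ p = \<delta> n ^ q * \<delta> n ^ (p - q)"
        using q by (simp flip: power_add)
      then show "w n q = \<delta> n ^ p * (c q * (1 / \<delta> n) ^ (p - q))"
        using d(1)[OF n] by (simp add: w_def power_one_over)
    qed (use d Q \<open>c p \<noteq> 0\<close> in auto)
  next
    assume "(\<lambda>n. (\<sigma> n)\<^sup>2) \<in> o(\<lambda>n. 1 - (\<alpha> n)\<^sup>2)"
    then have "(\<lambda>n. sqrt ((\<sigma> n)\<^sup>2 / (1 - (\<alpha> n)\<^sup>2))) \<longlonglongrightarrow> sqrt 0"
      by (intro tendsto_intros smalloD_tendsto)
    moreover have "\<forall>\<^sub>F n in sequentially. sqrt ((\<sigma> n)\<^sup>2 / (1 - (\<alpha> n)\<^sup>2)) = \<delta> n"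
      using eventually_ge_at_top[of 1] by eventually_elim (simp add: \<delta>)
    ultimately have "\<delta> \<longlonglongrightarrow> sqrt 0"
      by (rule Lim_transform_eventually)
    then have "\<delta> \<longlonglongrightarrow> 0"
      by simp
    then show "converges_in_distribution skorokhod_topology M (\<lambda>n. path_of (normalized_sum M X (f n) n))
      N (path_of (\<lambda>t \<omega>. t * (sgn (c m) * hermite m (Z \<omega>) / sqrt (fact m))))"
    proof (rule limit[of m "\<lambda>n. \<delta> n ^ m" \<delta> "\<lambda>q. q - m", rotated 4])
      fix n q :: nat assume n: "1 \<le> n" and q: "q \<in> ?Q"
      have "\<delta> n ^ q = \<delta> n ^ m * \<delta> n ^ (q - m)"
        using q by (simp flip: power_add)
      then show "w n q = \<delta> n ^ m * (c q * \<delta> n ^ (q - m))"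
        by (simp add: w_def)
    qed (use d Q \<open>c m \<noteq> 0\<close> in auto)
  qed
qed

end
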